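(* Let $K$ be one of $\mathcal{M}(\mathbf{C})$, $\mathbf{C}(\{z\})$, $\mathbf{C}((z))$, let $0\ne P\in\mathcal{D}_{q,K}$ and let $\mu\in\mathbf{Z}$ be a slope of $P$. Let $c_1,\ldots,c_p$ be the (distinct) exponents attached to the slope $\mu$ that lie in one given class modulo $q^{\mathbf{Z}}$, and $m_1,\ldots,m_p$ their respective multiplicities. Suppose the $c_i$ are indexed so that $\epsilon(c_1)<\cdots<\epsilon(c_p)$. Then there is a unique factorization $P=QR$ in $\mathcal{D}_{q,\mathbf{C}((z))}$ such that no exponent attached to the slope $\mu$ of $Q$ is congruent to the $c_i$ modulo $q^{\mathbf{Z}}$ and such that $R=R_1\cdots R_p$, with $$\forall i\in\{1,\ldots,p\},\quad R_i=(z^{\mu}\sigma_q-c_i)\,u_{i,m_i}^{-1}\cdots(z^{\mu}\sigma_q-c_i)\,u_{i,1}^{-1},$$ the $u_{i,j}$ being formal power series in $z$ with $u_{i,j}(0)=1$. Moreover $r_R=(m_1+\cdots+m_p)\delta_\mu$ and $\overline{R}^{(\mu)}=\prod_{i=1}^p(X-c_i)^{m_i}$.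
   Context: Fix $q\in\mathbf{C}$ with $|q|>1$. $\mathcal{M}(\mathbf{C})$ is the field of meromorphic functions on $\mathbf{C}$, $\mathbf{C}(\{z\})$ the field of germs of meromorphic functions at $0$, and $\mathbf{C}((z))$ the field of formal Laurent series; $\mathcal{M}(\mathbf{C})\subset\mathbf{C}(\{z\})\subset\mathbf{C}((z))$ via Laurent expansion at $0$. $v_0$ is the $z$-adic valuation and $\sigma_q$ the automorphism $f(z)\mapsto f(qz)$. For such a field $K$, $\mathcal{D}_{q,K}=K\langle\sigma_q,\sigma_q^{-1}\rangle$ is the ring of non-commutative Laurent polynomials $\sum a_i\sigma_q^i$ with $\sigma_q^k x=\sigma_q^k(x)\sigma_q^k$ ($x\in K$, $k\in\mathbf{Z}$); elements $u\in K$ are viewed as operators of degree $0$ (multiplication). Newton polygon: for $0\neq P=\sum a_i\sigma_q^i\in\mathcal{D}_{q,K}$, $N(P)$ is the convex hull of $\{(i,j)\in\mathbf{Z}^2: j\ge v_0(a_i)\}$. Its boundary consists of two vertical half-lines and vectors $(r_1,d_1),\ldots,(r_k,d_k)\in\mathbf{N}^*\times\mathbf{Z}$ of slopes $\mu_i=d_i/r_i$, with $\mu_1<\cdots<\mu_k$. $S(P)=\{\mu_1,\ldots,\mu_k\}$ is the set of slopes, and $r_P=\sum_i r_i\delta_{\mu_i}:\mathbf{Q}\to\mathbf{N}$, where $\delta_\mu$ is the indicator function of $\{\mu\}$. Characteristic polynomial: for $\mu\in\mathbf{Z}$ put $P'=\sum a_i'\sigma_q^i$ with $a_i'=a_i\,q^{-\mu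 i(i-1)/2}z^{-\mu i}$, let $\ell=\min_i v_0(a_i')$ and $b_i=z^{-\ell}a_i'$. Then $\overline{P}^{(\mu)}(s)=\sum_i b_i(0)s^i\in\mathbf{C}[s,s^{-1}]$, considered as defined up to a factor $\lambda s^k$, $\lambda\in\mathbf{C}^*$, $k\in\mathbf{Z}$ (identities between characteristic polynomials are understood up to such factors). It is a non-zero constant (up to such a factor) if $\mu$ is not a slope. The exponents attached to the slope $\mu$ are the non-zero roots of $\overline{P}^{(\mu)}$, with their multiplicities as roots. Each $c\in\mathbf{C}^*$ is written uniquely $c=q^{\epsilon(c)}\overline{c}$ with $\epsilon(c)\in\mathbf{Z}$, $1\le|\overline{c}|<|q|$. *)

theory Defs
  imports
    "HOL-Complex_Analysis.Complex_Analysis"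
    "HOL-Library.Poly_Mapping"
begin

section \<open>The fields of coefficients\<close>

text \<open>
  All three fields are regarded as subfields of \<open>complex fls\<close>, the field of formal Laurent
  series, via Laurent expansion at 0.
\<close>

definition meromorphic_field :: "complex fls set" where
  "meromorphic_field = {F. \<exists>f. f meromorphic_on UNIV \<and> f has_laurent_expansion F}"

definition germ_field :: "complex fls set" where
  "germ_field = {F. \<exists>f. f meromorphic_on {0} \<and> f has_laurent_expansion F}"

text \<open>\<open>sigma_q q k\<close> is the \<open>k\<close>-th iterate of the automorphism \<open>f(z) \<mapsto> f(q z)\<close>.\<close>

definition sigma_q :: "complex \<Rightarrow> int \<Rightarrow> complex fls \<Rightarrow> complex fls" where
  "sigma_q q k F = fls_compose_fps F (fps_const (q powi k) * fps_X)"

lemma nth_sigma: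
  assumes "q \<noteq> 0"
  shows "fls_nth (sigma_q q k F) n = q powi (k * n) * fls_nth F n"
  using assms by (simp add: sigma_q_def fls_nth_fls_compose_fps_linear power_int_mult)

lemma sigma_ring_hom:
  assumes "q \<noteq> 0"
  shows "sigma_q q k 0 = 0" "sigma_q q k 1 = 1" "sigma_q q k (F + G) = sigma_q q k F + sigma_q q k G"
    "sigma_q q k (F * G) = sigma_q q k F * sigma_q q k G"
proof -
  have H: "fps_const (q powi k) * fps_X \<noteq> (0 :: complex fps)" "fps_nth (fps_const (q powi k) * fps_X) 0 = 0"
    using assms by auto
  show "sigma_q q k 0 = 0" "sigma_q q k 1 = 1" "sigma_q q k (F + G) = sigma_q q k F + sigma_q q k G"
    "sigma_q q k (F * G) = sigma_q q k F * sigma_q q k G"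
    using H by (auto simp: sigma_q_def fls_compose_fps_add fls_compose_fps_mult)
qed

lemma sigma_sigma:
  assumes "q \<noteq> 0"
  shows "sigma_q q j (sigma_q q k F) = sigma_q q (j + k) F" "sigma_q q 0 F = F"
  using assms by (auto simp: fls_eq_iff nth_sigma power_int_add distrib_right)


section \<open>The ring of \<open>q\<close>-difference operators\<close>

text \<open>
  The finitely supported map \<open>P\<close> stands for the operator whose coefficient of the \<open>i\<close>-th power
  of \<open>\<sigma>\<^sub>q\<close> (coefficients written on the left) is \<open>lookup P i\<close>. Addition and the unit are those of
  \<open>Poly_Mapping\<close>. The product is \<open>qmult q\<close> below; the product \<open>*\<close> of \<open>Poly_Mapping\<close> is the
  untwisted convolution and is never used on operators.
\<close>

type_synonym qop = "int \<Rightarrow>\<^sub>0 complex fls"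

definition qmult :: "complex \<Rightarrow> qop \<Rightarrow> qop \<Rightarrow> qop" where
  "qmult q P Q =
     (\<Sum>i\<in>Poly_Mapping.keys P. \<Sum>j\<in>Poly_Mapping.keys Q.
        Poly_Mapping.single (i + j)
          (Poly_Mapping.lookup P i * sigma_q q i (Poly_Mapping.lookup Q j)))"

definition qprod_list :: "complex \<Rightarrow> qop list \<Rightarrow> qop" where
  "qprod_list q Ps = foldr (qmult q) Ps 1"

definition qops_over :: "complex fls set \<Rightarrow> qop set" where
  "qops_over K = {P. \<forall>i. Poly_Mapping.lookup P i \<in> K}"

definition mult_op :: "complex fls \<Rightarrow> qop" where
  "mult_op F = Poly_Mapping.single 0 F"

lemma qop_induct [case_names zero single add]:
  assumes "Pr 0" "\<And>i F. Pr (Poly_Mapping.single i F)" "\<And>P Q :: qop. Pr P \<Longrightarrow> Pr Q \<Longrightarrow> Pr (P + Q)"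
  shows "Pr P"
proof -
  have P: "P = (\<Sum>i\<in>Poly_Mapping.keys P. Poly_Mapping.single i (Poly_Mapping.lookup P i))"
    by (rule poly_mapping_eqI)
       (auto simp: lookup_sum lookup_single when_def if_distrib sum.delta' in_keys_iff cong: if_cong)
  have "finite A \<Longrightarrow> Pr (\<Sum>i\<in>A. Poly_Mapping.single i (Poly_Mapping.lookup P i))" for A
    by (induction A rule: finite_induct) (auto intro: assms)
  from this[of "Poly_Mapping.keys P"] P show ?thesis by simp
qed

lemma qmult_superset:
  assumes "q \<noteq> 0" "finite A" "finite B" "Poly_Mapping.keys P \<subseteq> A" "Poly_Mapping.keys Q \<subseteq> B"
  shows "qmult q P Q = (\<Sum>i\<in>A. \<Sum>j\<in>B. Poly_Mapping.single (i + j)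
           (Poly_Mapping.lookup P i * sigma_q q i (Poly_Mapping.lookup Q j)))"
proof -
  have "qmult q P Q = (\<Sum>i\<in>Poly_Mapping.keys P. \<Sum>j\<in>B. Poly_Mapping.single (i + j)
           (Poly_Mapping.lookup P i * sigma_q q i (Poly_Mapping.lookup Q j)))"
    unfolding qmult_def using assms
    by (intro sum.cong refl sum.mono_neutral_left) (auto simp: in_keys_iff sigma_ring_hom)
  also have "\<dots> = (\<Sum>i\<in>A. \<Sum>j\<in>B. Poly_Mapping.single (i + j)
           (Poly_Mapping.lookup P i * sigma_q q i (Poly_Mapping.lookup Q j)))"
    using assms by (intro sum.mono_neutral_left) (auto simp: in_keys_iff)
  finally show ?thesis .
qed

lemma qmult_single_single:
  assumes "q \<noteq> 0"
  shows "qmult q (Poly_Mapping.single i F) (Poly_Mapping.single j G) =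
           Poly_Mapping.single (i + j) (F * sigma_q q i G)"
  by (subst qmult_superset[of q "{i}" "{j}"]) (use assms in auto)

lemma qmult_add:
  assumes "q \<noteq> 0"
  shows "qmult q (P + P') Q = qmult q P Q + qmult q P' Q"
    and "qmult q P (Q + Q') = qmult q P Q + qmult q P Q'"
proof -
  define A where "A = Poly_Mapping.keys P \<union> Poly_Mapping.keys P' \<union> Poly_Mapping.keys (P + P')"
  define B where "B = Poly_Mapping.keys Q \<union> Poly_Mapping.keys Q' \<union> Poly_Mapping.keys (Q + Q')"
  note * = qmult_superset[OF assms, of A B]
  have [simp]: "finite A" "finite B" by (auto simp: A_def B_def)
  show "qmult q (P + P') Q = qmult q P Q + qmult q P' Q"
    by (subst (1 2 3) *)
       (auto simp: A_def B_def lookup_add distrib_right single_add sum.distrib)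
  show "qmult q P (Q + Q') = qmult q P Q + qmult q P Q'"
    by (subst (1 2 3) *)
       (auto simp: A_def B_def lookup_add distrib_left single_add sum.distrib sigma_ring_hom assms)
qed

lemma qmult_0 [simp]: "qmult q 0 P = 0" "qmult q P 0 = 0"
  by (simp_all add: qmult_def)

lemma qmult_1:
  assumes "q \<noteq> 0"
  shows "qmult q 1 P = P" "qmult q P 1 = P"
proof -
  show "qmult q 1 P = P"
    by (induction P rule: qop_induct)
       (use assms in \<open>auto simp: qmult_add qmult_single_single sigma_sigma simp flip: single_one\<close>)
  show "qmult q P 1 = P"
    by (induction P rule: qop_induct)
       (use assms in \<open>auto simp: qmult_add qmult_single_single sigma_ring_hom simp flip: single_one\<close>)
qed

lemma qmult_assoc:
  assumes "q \<noteq> 0"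
  shows "qmult q (qmult q P Q) R = qmult q P (qmult q Q R)"
proof (induction P rule: qop_induct)
  case (single i F)
  show ?case
  proof (induction Q rule: qop_induct)
    case (single j G)
    show ?case
      by (induction R rule: qop_induct)
         (use assms in \<open>auto simp: qmult_add qmult_single_single sigma_ring_hom sigma_sigma mult.assoc add.assoc\<close>)
  qed (use assms in \<open>auto simp: qmult_add\<close>)
qed (use assms in \<open>auto simp: qmult_add\<close>)

lemma qmult_commutation_rule:
  assumes "q \<noteq> 0"
  shows "qmult q (Poly_Mapping.single k 1) (mult_op F) =
           qmult q (mult_op (sigma_q q k F)) (Poly_Mapping.single k 1)"
  using assms by (simp add: mult_op_def qmult_single_single sigma_ring_hom)


section \<open>Newton polygon\<close>

text \<open>
  \<open>fls_subdegree\<close> is the \<open>z\<close>-adic valuation of a non-zero series. As the valuation of 0 is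
  infinite, vanishing coefficients contribute no point; this is why \<open>i\<close> is restricted to the
  support (\<open>fls_subdegree 0\<close> is \<open>0\<close>).
\<close>

definition newton_polygon :: "qop \<Rightarrow> (real \<times> real) set" where
  "newton_polygon P =
     convex hull {(of_int i, of_int j) | i j :: int.
       i \<in> Poly_Mapping.keys P \<and> fls_subdegree (Poly_Mapping.lookup P i) \<le> j}"

text \<open>The vectors \<open>(r, d)\<close> spanned by the non-vertical edges; a vertical edge would need \<open>r = 0\<close>.\<close>

definition newton_vectors :: "qop \<Rightarrow> (nat \<times> int) set" where
  "newton_vectors P = {(r, d). 0 < r \<and>
     (\<exists>x y. closed_segment (x, y) (x + of_nat r, y + of_int d) edge_of newton_polygon P)}"

definition slopes :: "qop \<Rightarrow> rat set" where
  "slopes P = (\<lambda>(r, d). of_int d / of_nat r) ` newton_vectors P"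

definition newton_rank :: "qop \<Rightarrow> rat \<Rightarrow> nat" where
  "newton_rank P \<mu> =
     (\<Sum>(r, d)\<in>newton_vectors P. if \<mu> = of_int d / of_nat r then r else 0)"


section \<open>Characteristic polynomials and exponents\<close>

text \<open>
  \<open>int \<Rightarrow>\<^sub>0 complex\<close>, with its (commutative) convolution product, is the ring of Laurent polynomials
  over the complex numbers; \<open>laurent_eq\<close> is equality up to a unit \<open>\<lambda> s\<^sup>k\<close>.
\<close>

type_synonym laurent_poly = "int \<Rightarrow>\<^sub>0 complex"

definition laurent_eq :: "laurent_poly \<Rightarrow> laurent_poly \<Rightarrow> bool" where
  "laurent_eq f g \<longleftrightarrow> (\<exists>c k. c \<noteq> 0 \<and> f = Poly_Mapping.single k c * g)"

definition twisted_coeff :: "complex \<Rightarrow> int \<Rightarrow> qop \<Rightarrow> int \<Rightarrow> complex fls" where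
  "twisted_coeff q \<mu> P i =
     Poly_Mapping.lookup P i
       * fls_const (q powi (- (\<mu> * (i * (i - 1) div 2)))) * fls_X_intpow (- (\<mu> * i))"

definition q_char_poly :: "complex \<Rightarrow> int \<Rightarrow> qop \<Rightarrow> laurent_poly" where
  "q_char_poly q \<mu> P =
     (let l = Min ((\<lambda>i. fls_subdegree (twisted_coeff q \<mu> P i)) ` Poly_Mapping.keys P)
      in \<Sum>i\<in>Poly_Mapping.keys P.
           Poly_Mapping.single i (fls_nth (fls_X_intpow (- l) * twisted_coeff q \<mu> P i) 0))"

text \<open>
  The multiple \<open>s\<^sup>k f\<close> of \<open>f \<noteq> 0\<close> that is an ordinary polynomial with non-zero constant term. Its
  roots, with multiplicities, are the non-zero roots of \<open>f\<close>.
\<close>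

definition laurent_to_poly :: "laurent_poly \<Rightarrow> complex poly" where
  "laurent_to_poly f =
     (\<Sum>i\<in>Poly_Mapping.keys f.
        monom (Poly_Mapping.lookup f i) (nat (i - Min (Poly_Mapping.keys f))))"

definition exponents :: "complex \<Rightarrow> int \<Rightarrow> qop \<Rightarrow> complex set" where
  "exponents q \<mu> P = {c. c \<noteq> 0 \<and> poly (laurent_to_poly (q_char_poly q \<mu> P)) c = 0}"

definition exponent_mult :: "complex \<Rightarrow> int \<Rightarrow> qop \<Rightarrow> complex \<Rightarrow> nat" where
  "exponent_mult q \<mu> P c = order c (laurent_to_poly (q_char_poly q \<mu> P))"

definition cong_q :: "complex \<Rightarrow> complex \<Rightarrow> complex \<Rightarrow> bool" where
  "cong_q q c d \<longleftrightarrow> (\<exists>n::int. c = q powi n * d)"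

definition q_epsilon :: "complex \<Rightarrow> complex \<Rightarrow> int" where
  "q_epsilon q c = (THE n. \<exists>d. c = q powi n * d \<and> 1 \<le> norm d \<and> norm d < norm q)"

lemma q_epsilon_unique:
  fixes q c :: complex
  assumes "norm q > 1" "c \<noteq> 0"
  shows "\<exists>!n::int. \<exists>d. c = q powi n * d \<and> 1 \<le> norm d \<and> norm d < norm q"
proof -
  have q: "q \<noteq> 0" using assms by auto
  define x where "x = log (norm q) (norm c)"
  have iff: "(\<exists>d. c = q powi n * d \<and> 1 \<le> norm d \<and> norm d < norm q) \<longleftrightarrow> n = \<lfloor>x\<rfloor>" for n :: int
  proof -
    have "(\<exists>d. c = q powi n * d \<and> 1 \<le> norm d \<and> norm d < norm q) \<longleftrightarrow>
          1 \<le> norm c / norm q powi n \<and> norm c / norm q powi n < norm q" (is "?L \<longleftrightarrow> _")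
    proof
      assume ?L
      then show "1 \<le> norm c / norm q powi n \<and> norm c / norm q powi n < norm q"
        using q by (auto simp: norm_mult norm_power_int)
    next
      assume "1 \<le> norm c / norm q powi n \<and> norm c / norm q powi n < norm q"
      then show ?L using q
        by (intro exI[of _ "c / q powi n"]) (auto simp: norm_divide norm_power_int)
    qed
    also have "\<dots> \<longleftrightarrow> norm q powi n \<le> norm c \<and> norm c < norm q powi (n + 1)"
      using q by (auto simp: field_simps power_int_add)
    also have "\<dots> \<longleftrightarrow> norm q powr of_int n \<le> norm c \<and> norm c < norm q powr of_int (n + 1)"
      using assms q powr_real_of_int'[of "norm q" n] powr_real_of_int'[of "norm q" "n + 1"] by auto
    also have "\<dots> \<longleftrightarrow> of_int n \<le> x \<and> x < of_int n + 1"
      using assms by (simp add: x_def le_log_iff log_less_iff)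
    also have "\<dots> \<longleftrightarrow> n = \<lfloor>x\<rfloor>" by linarith
    finally show ?thesis .
  qed
  show ?thesis unfolding iff by simp
qed


section \<open>The factorization\<close>

text \<open>\<open>(z\<^sup>\<mu> \<sigma>\<^sub>q - c) u\<^sup>-\<^sup>1\<close>\<close>

definition elem_factor :: "complex \<Rightarrow> int \<Rightarrow> complex \<Rightarrow> complex fps \<Rightarrow> qop" where
  "elem_factor q \<mu> c u =
     qmult q (Poly_Mapping.single 1 (fls_X_intpow \<mu>) - mult_op (fls_const c))
       (mult_op (inverse (fps_to_fls u)))"

text \<open>The factors of \<open>R\<^sub>i\<close> are written with \<open>j\<close> decreasing from \<open>m\<close> to \<open>1\<close> from left to right.\<close>

definition block_factor :: "complex \<Rightarrow> int \<Rightarrow> complex \<Rightarrow> nat \<Rightarrow> (nat \<Rightarrow> complex fps) \<Rightarrow> qop" where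
  "block_factor q \<mu> c m u =
     qprod_list q (map (\<lambda>j. elem_factor q \<mu> c (u j)) (rev [1..<m+1]))"

definition adapted_factorization ::
  "complex \<Rightarrow> int \<Rightarrow> nat \<Rightarrow> (nat \<Rightarrow> complex) \<Rightarrow> (nat \<Rightarrow> nat) \<Rightarrow> qop \<Rightarrow> qop \<times> qop \<Rightarrow> bool" where
  "adapted_factorization q \<mu> p c m P = (\<lambda>(Q, R).
     P = qmult q Q R \<and>
     (\<forall>d\<in>exponents q \<mu> Q. \<forall>i\<in>{1..p}. \<not> cong_q q d (c i)) \<and>
     (\<exists>u :: nat \<Rightarrow> nat \<Rightarrow> complex fps.
        (\<forall>i\<in>{1..p}. \<forall>j\<in>{1..m i}. fps_nth (u i j) 0 = 1) \<and>
        R = qprod_list q (map (\<lambda>i. block_factor q \<mu> (c i) (m i) (u i)) [1..<p+1])))"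

end

(*
  Put tau = z^mu sigma_q and write an operator as a Laurent polynomial in tau with coefficients on
  the left. A factor (tau - c) u^-1 with u(0) = 1 splits off P on the right iff substituting c for
  tau in P u gives 0. Comparing coefficients of z, this is a triangular linear system for the
  coefficients of u: with chi the characteristic polynomial of P, the equation of order 0 is
  chi(c) = 0 and u_n occurs in the equation of order n with coefficient chi(q^n c). So u exists and
  is unique whenever c is a root of chi and no q^n c with n >= 1 is one, i.e. for the exponent
  with the largest epsilon in its class. The characteristic polynomial of the cofactor is
  chi/(X - c), and iterating yields existence and uniqueness of the whole factorization.
*)
theory Submission
  imports Defs
begin

section \<open>Laurent polynomials in one variable\<close>

text \<open>The values chi(q^n c) stem from tau^i z^j = q^(i j) z^j tau^i: moving u to the left of
  tau^i and then putting tau = c replaces c by q^j c. Substitution is not multiplicative, but for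
  nonzero c it vanishes exactly on the left multiples of tau - c; as tau is invertible, the division
  that proves this also runs through negative powers. Factors leave at the right end of R_1 ... R_p,
  so increasing epsilon always offers the largest remaining exponent of the class; a repeated
  exponent does not block itself, as |q| > 1 excludes c = q^n c. Writing chi as g times linear
  factors, with g free of zeros in the class, reduces each stage to cancelling one factor in an
  integral domain and leaves g as the characteristic polynomial of Q. The rank of R is not
  determined by its characteristic polynomial alone. It comes from the support of R, from the
  absence of negative powers of z in its expansion in tau, and from the two nonzero end coefficients
  at order 0: together they make the Newton polygon a half-strip above a line of slope mu.\<close>

lemma poly_mapping_sum_single:
  "f = (\<Sum>i\<in>Poly_Mapping.keys f. Poly_Mapping.single i (Poly_Mapping.lookup f i))"
  by (rule poly_mapping_eqI)
     (auto simp: lookup_sum lookup_single when_def if_distrib sum.delta' in_keys_iff cong: if_cong)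

lemma poly_mapping_single_add_induct [case_names zero single add]:
  fixes f :: "'a \<Rightarrow>\<^sub>0 'b :: comm_monoid_add"
  assumes "Pr 0" "\<And>i x. Pr (Poly_Mapping.single i x)" "\<And>f g. Pr f \<Longrightarrow> Pr g \<Longrightarrow> Pr (f + g)"
  shows "Pr f"
proof -
  have "finite A \<Longrightarrow> Pr (\<Sum>i\<in>A. Poly_Mapping.single i (Poly_Mapping.lookup f i))" for A
    by (induction A rule: finite_induct) (auto intro: assms)
  from this[of "Poly_Mapping.keys f"] poly_mapping_sum_single[of f] show ?thesis by simp
qed

lemma lookup_mult_single:
  fixes f :: "int \<Rightarrow>\<^sub>0 'a :: comm_semiring_1"
  shows "Poly_Mapping.lookup (f * Poly_Mapping.single k x) i = Poly_Mapping.lookup f (i - k) * x"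
  by (induction f rule: poly_mapping_single_add_induct)
     (auto simp: mult_single lookup_single when_def distrib_right lookup_add algebra_simps)

section \<open>Evaluation of Laurent polynomials\<close>

definition leval :: "complex \<Rightarrow> laurent_poly \<Rightarrow> complex" where
  "leval s f = (\<Sum>i\<in>Poly_Mapping.keys f. Poly_Mapping.lookup f i * s powi i)"

lemma leval_superset:
  assumes "finite A" "Poly_Mapping.keys f \<subseteq> A"
  shows "leval s f = (\<Sum>i\<in>A. Poly_Mapping.lookup f i * s powi i)"
  unfolding leval_def using assms by (intro sum.mono_neutral_left) (auto simp: in_keys_iff)

lemma leval_simps [simp]:
  "leval s 0 = 0" "leval s (Poly_Mapping.single k x) = x * s powi k"
  by (auto simp: leval_def)

lemma leval_add [simp]: "leval s (f + g) = leval s f + leval s g"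
proof -
  define A where "A = Poly_Mapping.keys f \<union> Poly_Mapping.keys g \<union> Poly_Mapping.keys (f + g)"
  have "finite A" by (auto simp: A_def)
  then show ?thesis
    by (subst (1 2 3) leval_superset[of A]) (auto simp: A_def lookup_add distrib_right sum.distrib)
qed

lemma leval_diff [simp]: "leval s (f - g) = leval s f - leval s g"
  using leval_add[of s "f - g" g] by simp

lemma leval_mult:
  assumes "s \<noteq> 0"
  shows "leval s (f * g) = leval s f * leval s g"
proof (induction f rule: poly_mapping_single_add_induct)
  case (single i x)
  show ?case
    by (induction g rule: poly_mapping_single_add_induct)
       (use assms in \<open>auto simp: mult_single distrib_left power_int_add\<close>)
qed (auto simp: distrib_right)

lemma leval_laurent_to_poly:
  assumes "s \<noteq> 0"
  shows "leval s f = s powi Min (Poly_Mapping.keys f) * poly (laurent_to_poly f) s"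
proof -
  have "s powi Min (Poly_Mapping.keys f) * s ^ nat (i - Min (Poly_Mapping.keys f)) = s powi i"
    if "i \<in> Poly_Mapping.keys f" for i
  proof -
    have "Min (Poly_Mapping.keys f) \<le> i" using that by simp
    then have "s ^ nat (i - Min (Poly_Mapping.keys f)) = s powi (i - Min (Poly_Mapping.keys f))"
      by (simp add: power_int_def)
    then show ?thesis using assms by (simp flip: power_int_add)
  qed
  then show ?thesis
    by (auto simp: leval_def laurent_to_poly_def poly_sum poly_monom sum_distrib_left
        mult.left_commute intro!: sum.cong)
qed

lemma exponents_eq:
  "exponents q \<mu> P = {d. d \<noteq> 0 \<and> leval d (q_char_poly q \<mu> P) = 0}"
  by (auto simp: exponents_def leval_laurent_to_poly)

section \<open>Ordinary polynomials inside the Laurent polynomials, and root multiplicities\<close>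

definition laurent_of_poly :: "complex poly \<Rightarrow> laurent_poly" where
  "laurent_of_poly p = (\<Sum>i\<le>degree p. Poly_Mapping.single (int i) (coeff p i))"

lemma lookup_laurent_of_poly:
  "Poly_Mapping.lookup (laurent_of_poly p) i = (if i < 0 then 0 else coeff p (nat i))"
proof (cases "i < 0")
  case False
  then obtain n where "i = int n" by (metis nonneg_int_cases not_less)
  then show ?thesis
    by (auto simp: laurent_of_poly_def lookup_sum lookup_single when_def sum.delta' coeff_eq_0)
qed (auto simp: laurent_of_poly_def lookup_sum lookup_single when_def intro!: sum.neutral)

lemma leval_laurent_of_poly: "leval s (laurent_of_poly p) = poly p s"
proof -
  have "leval s (\<Sum>i\<in>A. f i) = (\<Sum>i\<in>A. leval s (f i))" if "finite A" for A :: "nat set" and f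
    using that by (induction A rule: finite_induct) auto
  then show ?thesis by (simp add: laurent_of_poly_def poly_altdef)
qed

abbreviation laurent_linear :: "complex \<Rightarrow> laurent_poly" where
  "laurent_linear c \<equiv> Poly_Mapping.single 1 1 - Poly_Mapping.single 0 c"

lemma lookup_mult_laurent_linear:
  "Poly_Mapping.lookup (f * laurent_linear c) i =
     Poly_Mapping.lookup f (i - 1) - c * Poly_Mapping.lookup f i"
  by (simp add: right_diff_distrib lookup_minus lookup_mult_single)

text \<open>Lets the simplifier see that \<open>laurent_linear c\<close> is nonzero, since it turns
  \<open>x - y = 0\<close> into \<open>x = y\<close>. Cancelling linear factors in the integral
  domain of Laurent polynomials rests on this.\<close>

lemma single_1_neq_single_0 [simp]: "Poly_Mapping.single 1 1 \<noteq> (Poly_Mapping.single 0 c :: laurent_poly)"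
proof
  assume "Poly_Mapping.single 1 1 = (Poly_Mapping.single 0 c :: laurent_poly)"
  then have "Poly_Mapping.lookup (Poly_Mapping.single 1 1 :: laurent_poly) 1 =
      Poly_Mapping.lookup (Poly_Mapping.single 0 c :: laurent_poly) 1" by simp
  then show False by (simp add: lookup_single)
qed

lemma laurent_of_poly_mult_linear:
  "laurent_of_poly (p * [:- c, 1:]) = laurent_of_poly p * laurent_linear c"
proof (rule poly_mapping_eqI)
  fix i :: int
  show "Poly_Mapping.lookup (laurent_of_poly (p * [:- c, 1:])) i =
      Poly_Mapping.lookup (laurent_of_poly p * laurent_linear c) i"
  proof (cases "i \<le> 0")
    case False
    then obtain n where n: "i = 1 + int n" by (metis zless_iff_Suc_zadd add_0 not_le of_nat_Suc)
    then have "nat i = Suc n" by simp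
    then show ?thesis by (simp add: n lookup_mult_laurent_linear lookup_laurent_of_poly)
  qed (auto simp: lookup_mult_laurent_linear lookup_laurent_of_poly)
qed

lemma laurent_of_poly_mult_linear_power:
  "laurent_of_poly (p * [:- c, 1:] ^ n) = laurent_of_poly p * laurent_linear c ^ n"
  by (induction n)
     (auto simp del: mult_pCons_right simp: laurent_of_poly_mult_linear power_Suc2 mult.assoc[symmetric] simp del: power_Suc)

lemma laurent_of_poly_mult_prod:
  assumes "finite A"
  shows "laurent_of_poly (p * (\<Prod>a\<in>A. [:- c a, 1:] ^ n a)) =
           laurent_of_poly p * (\<Prod>a\<in>A. laurent_linear (c a) ^ n a)"
  using assms
proof (induction A arbitrary: p rule: finite_induct)
  case (insert a A)
  have "p * (\<Prod>a\<in>insert a A. [:- c a, 1:] ^ n a) = (p * [:- c a, 1:] ^ n a) * (\<Prod>a\<in>A. [:- c a, 1:] ^ n a)"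
    using insert.hyps by (simp add: mult.assoc)
  then have "laurent_of_poly (p * (\<Prod>a\<in>insert a A. [:- c a, 1:] ^ n a)) =
      laurent_of_poly p * laurent_linear (c a) ^ n a * (\<Prod>a\<in>A. laurent_linear (c a) ^ n a)"
    by (simp only: insert.IH laurent_of_poly_mult_linear_power)
  then show ?case by (simp only: prod.insert[OF insert.hyps] mult.assoc)
qed simp

text \<open>Only the unit X^M, with M the lowest exponent, separates the two, so a factorization of
  the ordinary polynomial carries over. For \<open>f = 0\<close> the minimum is unspecified, but
  both sides are 0.\<close>

lemma laurent_to_poly_shift:
  "f = laurent_of_poly (laurent_to_poly f) * Poly_Mapping.single (Min (Poly_Mapping.keys f)) 1"
proof (rule poly_mapping_eqI)
  fix i
  define M where "M = Min (Poly_Mapping.keys f)"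
  have le: "M \<le> j" if "j \<in> Poly_Mapping.keys f" for j using that by (simp add: M_def)
  have "coeff (laurent_to_poly f) n = Poly_Mapping.lookup f (M + int n)" for n
  proof -
    have "coeff (laurent_to_poly f) n =
        (\<Sum>j\<in>Poly_Mapping.keys f. if j = M + int n then Poly_Mapping.lookup f j else 0)"
      unfolding laurent_to_poly_def coeff_sum M_def[symmetric]
      using le by (intro sum.cong) (auto simp: coeff_monom nat_eq_iff)
    then show ?thesis by (simp add: in_keys_iff)
  qed
  then show "Poly_Mapping.lookup f i = Poly_Mapping.lookup (laurent_of_poly (laurent_to_poly f) *
      Poly_Mapping.single (Min (Poly_Mapping.keys f)) 1) i"
    using le[of i]
    by (cases "i < M") (auto simp: lookup_mult_single lookup_laurent_of_poly M_def[symmetric] in_keys_iff)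
qed

text \<open>Roots are split off one at a time: the product over the roots already treated does not
  vanish at a new root \<open>a\<close>, so \<open>p\<close> and the remaining factor
  \<open>g\<close> have the same order at \<open>a\<close>.\<close>

lemma poly_order_decomp_finite:
  fixes p :: "'a :: field poly"
  assumes "finite A" "p \<noteq> 0"
  shows "\<exists>g. p = g * (\<Prod>a\<in>A. [:- a, 1:] ^ order a p) \<and> (\<forall>a\<in>A. poly g a \<noteq> 0)"
  using assms(1)
proof (induction A rule: finite_induct)
  case (insert a A)
  then obtain g where g: "p = g * (\<Prod>a\<in>A. [:- a, 1:] ^ order a p)" "\<forall>a\<in>A. poly g a \<noteq> 0"
    by blast
  have g0: "g \<noteq> 0" using g assms by auto
  obtain h where h: "g = [:- a, 1:] ^ order a g * h" "\<not> [:- a, 1:] dvd h"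
    using order_decomp[OF g0] by blast
  have nz: "poly (\<Prod>a\<in>A. [:- a, 1:] ^ order a p) a \<noteq> 0"
    using insert.hyps by (auto simp: poly_prod)
  have "order a p = order a g + order a (\<Prod>a\<in>A. [:- a, 1:] ^ order a p)"
    using g assms by (metis order_mult)
  also have "order a (\<Prod>a\<in>A. [:- a, 1:] ^ order a p) = 0"
    using nz by (rule order_0I)
  finally have "order a p = order a g" by simp
  then have g': "g = h * [:- a, 1:] ^ order a p" using h(1) by (simp only: mult.commute)
  have "p = h * (\<Prod>a\<in>insert a A. [:- a, 1:] ^ order a p)"
  proof -
    have "p = (h * [:- a, 1:] ^ order a p) * (\<Prod>a\<in>A. [:- a, 1:] ^ order a p)"
      by (subst g'[symmetric]) (rule g(1))
    then show ?thesis by (simp only: prod.insert[OF insert.hyps] mult.assoc)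
  qed
  moreover have "poly h b \<noteq> 0" if "b \<in> insert a A" for b
  proof (cases "b = a")
    case True
    then show ?thesis using h(2) by (simp add: poly_eq_0_iff_dvd)
  next
    case False
    then have "poly g b \<noteq> 0" using g(2) that by blast
    then show ?thesis by (subst (asm) g') simp
  qed
  ultimately show ?case by blast
qed auto


section \<open>Twisted coefficients and division by linear operators\<close>

text \<open>The Cauchy product, for any lower bound \<open>l\<close> of the support instead of the
  valuation of \<open>F\<close>, so that one \<open>l\<close> serves all twisted coefficients of an
  operator at once.\<close>

lemma fls_nth_mult_fps_to_fls:
  fixes F :: "'a :: comm_ring_1 fls"
  assumes "\<And>k. k < l \<Longrightarrow> fls_nth F k = 0"
  shows "fls_nth (F * fps_to_fls f) (l + int n) = (\<Sum>j\<le>n. fps_nth f j * fls_nth F (l + int (n - j)))"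
    and "k < l \<Longrightarrow> fls_nth (F * fps_to_fls f) k = 0"
proof -
  define g where "g = Abs_fps (\<lambda>n. fls_nth F (l + int n))"
  have F: "F = fls_shift (- l) (fps_to_fls g)"
  proof (rule fls_eqI)
    fix k
    show "fls_nth F k = fls_nth (fls_shift (- l) (fps_to_fls g)) k"
      using assms[of k] by (auto simp: g_def)
  qed
  have *: "F * fps_to_fls f = fls_shift (- l) (fps_to_fls (f * g))"
    by (subst F) (simp add: fls_times_fps_to_fls fls_shifted_times_simps mult.commute)
  show "fls_nth (F * fps_to_fls f) (l + int n) = (\<Sum>j\<le>n. fps_nth f j * fls_nth F (l + int (n - j)))"
    unfolding * by (simp add: fps_mult_nth g_def atLeast0AtMost)
  show "k < l \<Longrightarrow> fls_nth (F * fps_to_fls f) k = 0"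
    unfolding * by simp
qed

lemma sigma_fps_to_fls:
  assumes "q \<noteq> 0"
  shows "sigma_q q i (fps_to_fls u) = fps_to_fls (Abs_fps (\<lambda>n. q powi (i * int n) * fps_nth u n))"
  using assms by (auto simp: fls_eq_iff nth_sigma)

lemma sigma_const: "q \<noteq> 0 \<Longrightarrow> sigma_q q i (fls_const x) = fls_const x"
  by (auto simp: fls_eq_iff nth_sigma)

lemma mult_op_1: "mult_op 1 = 1"
  by (simp add: mult_op_def)

definition qlinear :: "int \<Rightarrow> complex \<Rightarrow> qop" where
  "qlinear \<mu> c = Poly_Mapping.single 1 (fls_X_intpow \<mu>) - mult_op (fls_const c)"

text \<open>
  If \<open>P = \<Sum>\<^sub>k z\<^sup>k f\<^sub>k(z\<^sup>\<mu> \<sigma>\<^sub>q)\<close> with Laurent polynomials \<open>f\<^sub>k\<close> over the complex numbers, then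
  \<open>zcoeff q \<mu> P k\<close> is \<open>f\<^sub>k\<close>.
\<close>

definition zcoeff :: "complex \<Rightarrow> int \<Rightarrow> qop \<Rightarrow> int \<Rightarrow> laurent_poly" where
  "zcoeff q \<mu> P k =
     (\<Sum>i\<in>Poly_Mapping.keys P. Poly_Mapping.single i (fls_nth (twisted_coeff q \<mu> P i) k))"

text \<open>The value obtained by substituting \<open>c\<close> for \<open>z\<^sup>\<mu> \<sigma>\<^sub>q\<close> in \<open>P\<close>, coefficients being on the left.\<close>

definition qremainder :: "complex \<Rightarrow> int \<Rightarrow> complex \<Rightarrow> qop \<Rightarrow> complex fls" where
  "qremainder q \<mu> c P = (\<Sum>i\<in>Poly_Mapping.keys P. twisted_coeff q \<mu> P i * fls_const (c powi i))"

context
  fixes q :: complex and \<mu> :: int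
  assumes q: "q \<noteq> 0"
begin

lemma mult_op_mult: "qmult q (mult_op F) (mult_op G) = mult_op (F * G)"
  using q by (simp add: mult_op_def qmult_single_single sigma_sigma)

lemma qmult_diff_right: "qmult q P (Q - Q') = qmult q P Q - qmult q P Q'"
  using qmult_add(2)[OF q, of P "Q - Q'" Q'] by (simp add: algebra_simps)

lemma qmult_diff_left: "qmult q (P - P') Q = qmult q P Q - qmult q P' Q"
  using qmult_add(1)[OF q, of "P - P'" P' Q] by (simp add: algebra_simps)

lemma lookup_qmult_single:
  "Poly_Mapping.lookup (qmult q P (Poly_Mapping.single k F)) i =
     Poly_Mapping.lookup P (i - k) * sigma_q q (i - k) F"
  by (induction P rule: qop_induct)
     (use q in \<open>auto simp: qmult_add lookup_add distrib_right qmult_single_single lookup_single when_def\<close>)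

section \<open>Coefficients with respect to powers of tau = z^mu sigma_q\<close>

lemma twisted_coeff_eq_0_iff: "twisted_coeff q \<mu> P i = 0 \<longleftrightarrow> i \<notin> Poly_Mapping.keys P"
  using q by (auto simp: twisted_coeff_def in_keys_iff fls_shift_eq0_iff)

lemma twisted_coeff_add:
  "twisted_coeff q \<mu> (P + Q) i = twisted_coeff q \<mu> P i + twisted_coeff q \<mu> Q i"
  by (simp add: twisted_coeff_def lookup_add distrib_right)

lemma twisted_coeff_qmult_mult_op:
  "twisted_coeff q \<mu> (qmult q P (mult_op F)) i = twisted_coeff q \<mu> P i * sigma_q q i F"
  by (simp add: twisted_coeff_def mult_op_def lookup_qmult_single)

text \<open>Since (z^mu sigma_q)^i = q^(mu i (i-1)/2) z^(mu i) sigma_q^i, the twisted coefficient is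
  the coefficient of tau^i in the expansion of \<open>P\<close> in powers of tau. Right
  multiplication by tau is then an index shift, and c commutes with tau.\<close>

lemma twisted_coeff_qmult_qlinear:
  "twisted_coeff q \<mu> (qmult q P (qlinear \<mu> c)) i =
     twisted_coeff q \<mu> P (i - 1) - fls_const c * twisted_coeff q \<mu> P i"
proof -
  have ev: "even ((i - 1) * (i - 2))" "even (i * (i - 1))" by auto
  have "(i - 1) * (i - 2) div 2 = i * (i - 1) div 2 - (i - 1)"
    using ev by (auto simp: algebra_simps elim!: evenE)
  then have e: "- (\<mu> * ((i - 1) * (i - 2) div 2)) = \<mu> * (i - 1) + - (\<mu> * (i * (i - 1) div 2))"
    by (simp only: right_diff_distrib minus_diff_eq)
  \<comment> \<open>This power of q is exactly the difference of the twists at i - 1 and i.\<close>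
  have s: "sigma_q q (i - 1) (fls_X_intpow \<mu>) = fls_const (q powi (\<mu> * (i - 1))) * fls_X_intpow \<mu>"
    using q by (auto simp: fls_eq_iff nth_sigma fls_X_intpow_times_conv_shift mult.commute)
  have x: "fls_X_intpow (- (\<mu> * (i - 1))) = fls_X_intpow \<mu> * (fls_X_intpow (- (\<mu> * i)) :: complex fls)"
    by (simp only: fls_X_intpow_times_fls_X_intpow) (simp add: algebra_simps)
  have shifted: "twisted_coeff q \<mu> P (i - 1) = Poly_Mapping.lookup P (i - 1) *
      sigma_q q (i - 1) (fls_X_intpow \<mu>) * fls_const (q powi (- (\<mu> * (i * (i - 1) div 2)))) *
      fls_X_intpow (- (\<mu> * i))"
    using q unfolding twisted_coeff_def s x
    by (simp only: diff_diff_eq one_add_one e power_int_add fls_const_mult_const[symmetric] mult_ac simp_thms)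
  have "twisted_coeff q \<mu> (qmult q P (qlinear \<mu> c)) i = Poly_Mapping.lookup P (i - 1) *
      sigma_q q (i - 1) (fls_X_intpow \<mu>) * fls_const (q powi (- (\<mu> * (i * (i - 1) div 2)))) *
      fls_X_intpow (- (\<mu> * i)) - fls_const c * twisted_coeff q \<mu> P i"
    by (simp add: qlinear_def qmult_diff_right twisted_coeff_def lookup_minus lookup_qmult_single
        mult_op_def sigma_const q left_diff_distrib right_diff_distrib mult_ac)
  then show ?thesis by (simp only: shifted)
qed

section \<open>The characteristic polynomial as the lowest coefficient in z\<close>

lemma lookup_zcoeff:
  "Poly_Mapping.lookup (zcoeff q \<mu> P k) i = fls_nth (twisted_coeff q \<mu> P i) k"
proof (cases "i \<in> Poly_Mapping.keys P")
  case True
  then show ?thesis by (simp add: zcoeff_def lookup_sum lookup_single when_def)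
next
  case False
  then have "twisted_coeff q \<mu> P i = 0" by (simp add: twisted_coeff_eq_0_iff)
  then show ?thesis using False by (auto simp: zcoeff_def lookup_sum lookup_single when_def)
qed

lemma zcoeff_least_index:
  assumes "P \<noteq> 0"
  obtains l where "zcoeff q \<mu> P l \<noteq> 0" "\<And>k. k < l \<Longrightarrow> zcoeff q \<mu> P k = 0"
proof -
  define S where "S = (\<lambda>i. fls_subdegree (twisted_coeff q \<mu> P i)) ` Poly_Mapping.keys P"
  have S: "finite S" "S \<noteq> {}" using assms by (auto simp: S_def)
  have "Min S \<in> (\<lambda>i. fls_subdegree (twisted_coeff q \<mu> P i)) ` Poly_Mapping.keys P"
    unfolding S_def[symmetric] using S by (rule Min_in)
  then obtain i where i: "Min S = fls_subdegree (twisted_coeff q \<mu> P i)" "i \<in> Poly_Mapping.keys P"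
    by (rule imageE)
  have "Poly_Mapping.lookup (zcoeff q \<mu> P (Min S)) i \<noteq> 0"
    unfolding lookup_zcoeff i(1) using i(2) twisted_coeff_eq_0_iff[of P i] by simp
  then have "zcoeff q \<mu> P (Min S) \<noteq> 0" by auto
  moreover have "zcoeff q \<mu> P k = 0" if "k < Min S" for k
  proof (rule poly_mapping_eqI)
    fix j
    have "twisted_coeff q \<mu> P j = 0 \<or> k < fls_subdegree (twisted_coeff q \<mu> P j)"
    proof (cases "j \<in> Poly_Mapping.keys P")
      case True
      then have "Min S \<le> fls_subdegree (twisted_coeff q \<mu> P j)" using S by (auto simp: S_def)
      then show ?thesis using that by simp
    qed (simp add: twisted_coeff_eq_0_iff)
    then show "Poly_Mapping.lookup (zcoeff q \<mu> P k) j = Poly_Mapping.lookup 0 j"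
      by (auto simp: lookup_zcoeff)
  qed
  ultimately show ?thesis using that by blast
qed

text \<open>The least valuation of the twisted coefficients is the first order at which some
  \<open>zcoeff\<close> is nonzero. The equality is exact, not up to a unit, so the product formulas
  below need no bookkeeping of units.\<close>

lemma q_char_poly_eq_zcoeff:
  assumes nz: "zcoeff q \<mu> P l \<noteq> 0" and below: "\<And>k. k < l \<Longrightarrow> zcoeff q \<mu> P k = 0"
  shows "q_char_poly q \<mu> P = zcoeff q \<mu> P l"
proof -
  have "\<exists>i. Poly_Mapping.lookup (zcoeff q \<mu> P l) i \<noteq> 0"
    using nz by (metis lookup_zero poly_mapping_eqI)
  then obtain i where i: "fls_nth (twisted_coeff q \<mu> P i) l \<noteq> 0" by (auto simp: lookup_zcoeff)
  then have ik: "i \<in> Poly_Mapping.keys P" using twisted_coeff_eq_0_iff[of P i] by auto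
  have below': "fls_nth (twisted_coeff q \<mu> P j) k = 0" if "k < l" for j k
    using below[OF that] lookup_zcoeff[of P k j] by simp
  have "Min ((\<lambda>i. fls_subdegree (twisted_coeff q \<mu> P i)) ` Poly_Mapping.keys P) = l"
  proof (rule Min_eqI)
    show "l \<in> (\<lambda>i. fls_subdegree (twisted_coeff q \<mu> P i)) ` Poly_Mapping.keys P"
      using ik i below' by (intro image_eqI[of _ _ i]) (auto intro!: fls_subdegree_eqI[symmetric])
  next
    fix y assume "y \<in> (\<lambda>i. fls_subdegree (twisted_coeff q \<mu> P i)) ` Poly_Mapping.keys P"
    then obtain j where "j \<in> Poly_Mapping.keys P" "y = fls_subdegree (twisted_coeff q \<mu> P j)" by auto
    then show "l \<le> y" using below' by (auto intro!: fls_subdegree_geI simp: twisted_coeff_eq_0_iff)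
  qed auto
  moreover have "fls_nth (fls_X_intpow (- l) * F) 0 = fls_nth F l" for F :: "complex fls"
    by (subst fls_X_intpow_times_conv_shift) simp
  ultimately show ?thesis
    by (simp only: q_char_poly_def zcoeff_def Let_def)
qed

lemma q_char_poly_nonzero: "P \<noteq> 0 \<Longrightarrow> q_char_poly q \<mu> P \<noteq> 0"
  by (metis zcoeff_least_index q_char_poly_eq_zcoeff)

text \<open>Right multiplication by tau - c acts on each f_k in z^k f_k(tau) separately, because z^k
  stays on the left.\<close>

lemma zcoeff_qmult_qlinear:
  "zcoeff q \<mu> (qmult q P (qlinear \<mu> c)) k = zcoeff q \<mu> P k * laurent_linear c"
  by (rule poly_mapping_eqI)
     (simp add: lookup_zcoeff twisted_coeff_qmult_qlinear lookup_mult_laurent_linear)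

text \<open>Moving z^j to the left of tau^i costs q^(i j); apart from this factor it is a Cauchy
  product.\<close>

lemma lookup_zcoeff_qmult_fps:
  assumes below: "\<And>k. k < l \<Longrightarrow> zcoeff q \<mu> P k = 0"
  shows "Poly_Mapping.lookup (zcoeff q \<mu> (qmult q P (mult_op (fps_to_fls u))) (l + int n)) i =
           (\<Sum>j\<le>n. q powi (i * int j) * fps_nth u j *
              Poly_Mapping.lookup (zcoeff q \<mu> P (l + int (n - j))) i)"
    and "k < l \<Longrightarrow> zcoeff q \<mu> (qmult q P (mult_op (fps_to_fls u))) k = 0"
proof -
  have b: "fls_nth (twisted_coeff q \<mu> P i) k = 0" if "k < l" for i k
    using below[OF that] lookup_zcoeff[of P k i] by simp
  show "Poly_Mapping.lookup (zcoeff q \<mu> (qmult q P (mult_op (fps_to_fls u))) (l + int n)) i =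
      (\<Sum>j\<le>n. q powi (i * int j) * fps_nth u j *
         Poly_Mapping.lookup (zcoeff q \<mu> P (l + int (n - j))) i)"
    using fls_nth_mult_fps_to_fls(1)[of l "twisted_coeff q \<mu> P i", OF b]
    by (simp add: lookup_zcoeff twisted_coeff_qmult_mult_op sigma_fps_to_fls q)
  show "zcoeff q \<mu> (qmult q P (mult_op (fps_to_fls u))) k = 0" if "k < l"
  proof (rule poly_mapping_eqI)
    fix i
    show "Poly_Mapping.lookup (zcoeff q \<mu> (qmult q P (mult_op (fps_to_fls u))) k) i = Poly_Mapping.lookup 0 i"
      using fls_nth_mult_fps_to_fls(2)[of l "twisted_coeff q \<mu> P i", OF b that]
      by (simp add: lookup_zcoeff twisted_coeff_qmult_mult_op sigma_fps_to_fls q)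
  qed
qed

text \<open>At the lowest order only the constant term of \<open>u\<close> contributes, and its
  value 1 changes nothing.\<close>

lemma q_char_poly_qmult_fps:
  assumes "P \<noteq> 0" "fps_nth u 0 = 1"
  shows "q_char_poly q \<mu> (qmult q P (mult_op (fps_to_fls u))) = q_char_poly q \<mu> P"
proof -
  obtain l where l: "zcoeff q \<mu> P l \<noteq> 0" "\<And>k. k < l \<Longrightarrow> zcoeff q \<mu> P k = 0"
    using zcoeff_least_index[OF assms(1)] by blast
  let ?P = "qmult q P (mult_op (fps_to_fls u))"
  have "zcoeff q \<mu> ?P l = zcoeff q \<mu> P l"
    by (rule poly_mapping_eqI)
       (use lookup_zcoeff_qmult_fps(1)[OF l(2), where n = 0] assms(2) in simp)
  then show ?thesis
    using l lookup_zcoeff_qmult_fps(2)[OF l(2)]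
      q_char_poly_eq_zcoeff[of P l] q_char_poly_eq_zcoeff[of ?P l] by simp
qed

lemma q_char_poly_qmult_qlinear:
  assumes "P \<noteq> 0"
  shows "q_char_poly q \<mu> (qmult q P (qlinear \<mu> c)) = q_char_poly q \<mu> P * laurent_linear c"
proof -
  obtain l where l: "zcoeff q \<mu> P l \<noteq> 0" "\<And>k. k < l \<Longrightarrow> zcoeff q \<mu> P k = 0"
    using zcoeff_least_index[OF assms] by blast
  then show ?thesis
    using q_char_poly_eq_zcoeff[of P l] q_char_poly_eq_zcoeff[of "qmult q P (qlinear \<mu> c)" l]
    by (simp add: zcoeff_qmult_qlinear)
qed

text \<open>A nonzero Laurent polynomial f_l stays nonzero after multiplication by X - c. Applied to
  a difference, this gives right cancellation of tau - c.\<close>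

lemma qmult_qlinear_nonzero:
  assumes "P \<noteq> 0"
  shows "qmult q P (qlinear \<mu> c) \<noteq> 0"
proof
  assume "qmult q P (qlinear \<mu> c) = 0"
  moreover obtain l where "zcoeff q \<mu> P l \<noteq> 0"
    using zcoeff_least_index[OF assms] by blast
  ultimately show False
    using zcoeff_qmult_qlinear[of P c l] by (simp add: zcoeff_def[of _ _ 0])
qed

lemma qmult_qlinear_cancel:
  assumes "qmult q P (qlinear \<mu> c) = qmult q P' (qlinear \<mu> c)"
  shows "P = P'"
  using qmult_qlinear_nonzero[of "P - P'" c] assms by (auto simp: qmult_diff_left)

section \<open>Division by tau - c with a remainder of degree 0\<close>

lemma qremainder_superset:
  assumes "finite A" "Poly_Mapping.keys P \<subseteq> A"
  shows "qremainder q \<mu> c P = (\<Sum>i\<in>A. twisted_coeff q \<mu> P i * fls_const (c powi i))"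
  unfolding qremainder_def using assms
  by (intro sum.mono_neutral_left) (auto simp: twisted_coeff_eq_0_iff)

lemma qremainder_add: "qremainder q \<mu> c (P + Q) = qremainder q \<mu> c P + qremainder q \<mu> c Q"
proof -
  define A where "A = Poly_Mapping.keys P \<union> Poly_Mapping.keys Q \<union> Poly_Mapping.keys (P + Q)"
  have "finite A" by (auto simp: A_def)
  then show ?thesis
    by (subst (1 2 3) qremainder_superset[of A])
       (auto simp: A_def twisted_coeff_add distrib_right sum.distrib)
qed

lemma qremainder_single:
  "qremainder q \<mu> c (Poly_Mapping.single i F) =
     twisted_coeff q \<mu> (Poly_Mapping.single i F) i * fls_const (c powi i)"
  by (subst qremainder_superset[of "{i}"]) auto

text \<open>A term t tau^i becomes t tau^(i+1) - c t tau^i, and both parts take the value t c^(i+1)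
  at tau = c. Additivity of the substitution does the rest.\<close>

lemma qremainder_qmult_qlinear:
  assumes "c \<noteq> 0"
  shows "qremainder q \<mu> c (qmult q P (qlinear \<mu> c)) = 0"
proof (induction P rule: qop_induct)
  case (single i F)
  have "Poly_Mapping.keys (qmult q (Poly_Mapping.single i F) (qlinear \<mu> c)) \<subseteq> {i, i + 1}"
    by (auto simp: in_keys_iff qlinear_def qmult_diff_right lookup_minus lookup_qmult_single
        mult_op_def lookup_single when_def split: if_splits)
  then have "qremainder q \<mu> c (qmult q (Poly_Mapping.single i F) (qlinear \<mu> c)) =
      (\<Sum>j\<in>{i, i + 1}. twisted_coeff q \<mu> (qmult q (Poly_Mapping.single i F) (qlinear \<mu> c)) j * fls_const (c powi j))"
    by (intro qremainder_superset) auto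
  moreover have "twisted_coeff q \<mu> (Poly_Mapping.single i F) j = 0" if "j \<noteq> i" for j
    using that by (simp add: twisted_coeff_eq_0_iff)
  ultimately show ?case
    using assms by (simp add: twisted_coeff_qmult_qlinear power_int_add algebra_simps flip: fls_const_mult_const)
next
  case (add P P')
  then show ?case by (simp add: qmult_add q qremainder_add)
qed (simp add: qremainder_def)

text \<open>Modulo left multiples of tau - c every term can be moved to degree 0, downwards from
  positive and upwards from negative powers. What is left over must be \<open>qremainder\<close>,
  which vanishes on such multiples.\<close>

lemma qmult_qlinear_division:
  assumes "c \<noteq> 0"
  shows "\<exists>Q. P = qmult q Q (qlinear \<mu> c) + mult_op (qremainder q \<mu> c P)"
proof (induction P rule: qop_induct)
  case zero
  show ?case by (intro exI[of _ 0]) (simp add: qremainder_def mult_op_def)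
next
  case (add P P')
  then obtain Q Q' where "P = qmult q Q (qlinear \<mu> c) + mult_op (qremainder q \<mu> c P)"
    "P' = qmult q Q' (qlinear \<mu> c) + mult_op (qremainder q \<mu> c P')" by blast
  then have "P + P' = qmult q (Q + Q') (qlinear \<mu> c) + mult_op (qremainder q \<mu> c (P + P'))"
    by (simp add: qmult_add q qremainder_add mult_op_def single_add add_ac)
  then show ?case by blast
next
  case (single i F)
  have reduce: "\<exists>Q. P = qmult q Q (qlinear \<mu> c) + mult_op (qremainder q \<mu> c P)"
    if eq: "P = qmult q Q0 (qlinear \<mu> c) + P'"
      and division: "\<exists>Q. P' = qmult q Q (qlinear \<mu> c) + mult_op (qremainder q \<mu> c P')" for P Q0 P'
  proof -
    obtain Q where Q: "P' = qmult q Q (qlinear \<mu> c) + mult_op (qremainder q \<mu> c P')"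
      using division by blast
    have "qremainder q \<mu> c P = qremainder q \<mu> c P'"
      by (simp add: eq qremainder_add qremainder_qmult_qlinear assms)
    then have "P = qmult q (Q0 + Q) (qlinear \<mu> c) + mult_op (qremainder q \<mu> c P)"
      using eq Q by (simp add: qmult_add q add.assoc)
    then show ?thesis by blast
  qed
  have qmult_single: "qmult q (Poly_Mapping.single i G) (qlinear \<mu> c) =
      Poly_Mapping.single (i + 1) (G * sigma_q q i (fls_X_intpow \<mu>)) -
      Poly_Mapping.single i (G * fls_const c)" for i G
    by (simp add: qlinear_def qmult_diff_right mult_op_def qmult_single_single q sigma_const)
  have X: "sigma_q q i (fls_X_intpow \<mu>) \<noteq> 0" for i
  proof
    assume "sigma_q q i (fls_X_intpow \<mu>) = 0"
    then have "fls_nth (sigma_q q i (fls_X_intpow \<mu>)) \<mu> = 0" by simp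
    then show False using q by (simp add: nth_sigma)
  qed
  show ?case
  proof (induction i arbitrary: F rule: int_induct[of _ 0])
    case base
    show ?case by (intro exI[of _ 0]) (simp add: qremainder_single mult_op_def twisted_coeff_def)
  next
    case (step1 i)
    \<comment> \<open>\<open>G\<close> makes the upper term of G sigma_q^i (tau - c) equal to F
      sigma_q^(i+1).\<close>
    define G where "G = F * inverse (sigma_q q i (fls_X_intpow \<mu>))"
    have "G * sigma_q q i (fls_X_intpow \<mu>) = F" using X[of i] by (simp add: G_def)
    then have "Poly_Mapping.single (i + 1) F =
        qmult q (Poly_Mapping.single i G) (qlinear \<mu> c) + Poly_Mapping.single i (G * fls_const c)"
      by (simp add: qmult_single)
    then show ?case by (rule reduce[OF _ step1(2)])
  next
    case (step2 i)
    \<comment> \<open>For negative powers the lower term is matched instead, which uses that c is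
      invertible.\<close>
    define G where "G = - (F * fls_const (inverse c))"
    have "G * fls_const c = - F" using assms by (simp add: G_def mult.assoc fls_const_mult_const)
    then have "Poly_Mapping.single (i - 1) F =
        qmult q (Poly_Mapping.single (i - 1) G) (qlinear \<mu> c) +
        Poly_Mapping.single i (- (G * sigma_q q (i - 1) (fls_X_intpow \<mu>)))"
      by (simp add: qmult_single single_uminus)
    then show ?case by (rule reduce[OF _ step2(2)])
  qed
qed

end


section \<open>Splitting off elementary factors\<close>

text \<open>Well-founded recursion solves row \<open>n\<close> for \<open>u n\<close>. Row 0 is left
  out: in the application it reads chi(c) = 0, and \<open>u 0 = 1\<close> is the
  normalization.\<close>

lemma exists_triangular_solution:
  fixes B :: "nat \<Rightarrow> nat \<Rightarrow> 'a :: field"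
  assumes B: "\<And>n. 1 \<le> n \<Longrightarrow> B n n \<noteq> 0"
  shows "\<exists>u. u 0 = 1 \<and> (\<forall>n\<ge>1. (\<Sum>j\<le>n. u j * B n j) = 0)"
proof -
  have "\<exists>u. \<forall>n. (n = 0 \<longrightarrow> u n = 1) \<and> (1 \<le> n \<longrightarrow> u n * B n n + (\<Sum>j<n. u j * B n j) = 0)"
  proof (rule dependent_wf_choice[OF wf_less])
    fix n :: nat and f :: "nat \<Rightarrow> 'a"
    show "\<exists>r. (n = 0 \<longrightarrow> r = 1) \<and> (1 \<le> n \<longrightarrow> r * B n n + (\<Sum>j<n. f j * B n j) = 0)"
      by (cases "n = 0")
         (auto intro!: exI[of _ "- (\<Sum>j<n. f j * B n j) / B n n"] simp: B)
  qed auto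
  then obtain u where "\<And>n. (n = 0 \<longrightarrow> u n = 1) \<and> (1 \<le> n \<longrightarrow> u n * B n n + (\<Sum>j<n. u j * B n j) = 0)"
    by blast
  then show ?thesis
    by (intro exI[of _ u]) (auto simp: lessThan_Suc_atMost[symmetric] add.commute)
qed

lemma triangular_solution_unique:
  fixes B :: "nat \<Rightarrow> nat \<Rightarrow> 'a :: field"
  assumes B: "\<And>n. 1 \<le> n \<Longrightarrow> B n n \<noteq> 0"
    and "u 0 = v 0" "\<And>n. 1 \<le> n \<Longrightarrow> (\<Sum>j\<le>n. u j * B n j) = (\<Sum>j\<le>n. v j * B n j)"
  shows "u n = v n"
proof (induction n rule: less_induct)
  case (less n)
  show ?case
  proof (cases "n = 0")
    case False
    have "(\<Sum>j<n. u j * B n j) = (\<Sum>j<n. v j * B n j)"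
      using less by (intro sum.cong) auto
    moreover have "(\<Sum>j\<le>n. w j * B n j) = (\<Sum>j<n. w j * B n j) + w n * B n n" for w
      by (simp add: lessThan_Suc_atMost[symmetric])
    ultimately show ?thesis using assms(3)[of n] B[of n] False by simp
  qed (use assms in auto)
qed

context
  fixes q :: complex and \<mu> :: int
  assumes q: "q \<noteq> 0"
begin

lemma keys_zcoeff_subset: "Poly_Mapping.keys (zcoeff q \<mu> P k) \<subseteq> Poly_Mapping.keys P"
proof
  fix i assume "i \<in> Poly_Mapping.keys (zcoeff q \<mu> P k)"
  then have "twisted_coeff q \<mu> P i \<noteq> 0" by (auto simp: in_keys_iff lookup_zcoeff[OF q])
  then show "i \<in> Poly_Mapping.keys P" by (simp add: twisted_coeff_eq_0_iff[OF q])
qed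

text \<open>As coefficients stand on the left, putting tau = c in the sum of the z^k f_k(tau)
  evaluates each f_k at c.\<close>

lemma fls_nth_qremainder: "fls_nth (qremainder q \<mu> c P) k = leval c (zcoeff q \<mu> P k)"
proof -
  have "fls_nth (\<Sum>i\<in>A. f i * fls_const (a i)) k = (\<Sum>i\<in>A. fls_nth (f i) k * a i)"
    if "finite A" for A :: "int set" and f :: "int \<Rightarrow> complex fls" and a
    using that by (induction A rule: finite_induct) auto
  then show ?thesis
    by (simp add: qremainder_def leval_superset[OF _ keys_zcoeff_subset] lookup_zcoeff[OF q])
qed

text \<open>The identity q^(i j) s^i = (q^j s)^i turns the twists into evaluations at q^j s. In the
  term \<open>j = n\<close> it is the coefficient of order \<open>l\<close> that is evaluated, at
  q^n s.\<close>

lemma leval_zcoeff_qmult_fps: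
  assumes "\<And>k. k < l \<Longrightarrow> zcoeff q \<mu> P k = 0"
  shows "leval s (zcoeff q \<mu> (qmult q P (mult_op (fps_to_fls u))) (l + int n)) =
           (\<Sum>j\<le>n. fps_nth u j * leval (q ^ j * s) (zcoeff q \<mu> P (l + int (n - j))))"
proof -
  define P' where "P' = qmult q P (mult_op (fps_to_fls u))"
  have keys: "Poly_Mapping.keys (zcoeff q \<mu> P' (l + int n)) \<subseteq> Poly_Mapping.keys P"
  proof
    fix i assume "i \<in> Poly_Mapping.keys (zcoeff q \<mu> P' (l + int n))"
    then have "twisted_coeff q \<mu> P' i \<noteq> 0"
      by (auto simp: in_keys_iff lookup_zcoeff[OF q])
    then have "twisted_coeff q \<mu> P i \<noteq> 0"
      by (auto simp: P'_def twisted_coeff_qmult_mult_op[OF q])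
    then show "i \<in> Poly_Mapping.keys P" by (simp add: twisted_coeff_eq_0_iff[OF q])
  qed
  have pow: "(q ^ j * s) powi i = q powi (i * int j) * s powi i" for i j
    by (metis mult.commute power_int_mult power_int_mult_distrib power_int_of_nat)
  have "leval s (zcoeff q \<mu> P' (l + int n)) =
      (\<Sum>i\<in>Poly_Mapping.keys P. (\<Sum>j\<le>n. q powi (i * int j) * fps_nth u j *
         Poly_Mapping.lookup (zcoeff q \<mu> P (l + int (n - j))) i) * s powi i)"
    unfolding leval_superset[OF finite_keys keys]
    unfolding P'_def using lookup_zcoeff_qmult_fps(1)[OF q assms] by simp
  also have "\<dots> = (\<Sum>j\<le>n. fps_nth u j *
      (\<Sum>i\<in>Poly_Mapping.keys P. Poly_Mapping.lookup (zcoeff q \<mu> P (l + int (n - j))) i * (q ^ j * s) powi i))"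
    unfolding sum_distrib_left sum_distrib_right pow
    by (subst sum.swap) (simp only: mult_ac)
  also have "\<dots> = (\<Sum>j\<le>n. fps_nth u j * leval (q ^ j * s) (zcoeff q \<mu> P (l + int (n - j))))"
    by (simp only: leval_superset[OF finite_keys keys_zcoeff_subset])
  finally show ?thesis by (simp add: P'_def)
qed

section \<open>One elementary factor on the right\<close>

lemma elem_factor_eq:
  "elem_factor q \<mu> c u = qmult q (qlinear \<mu> c) (mult_op (inverse (fps_to_fls u)))"
  by (simp add: elem_factor_def qlinear_def)

text \<open>Right multiplication by \<open>u\<close> clears the inverse, which leaves a question of
  divisibility by tau - c.\<close>

lemma eq_qmult_elem_factor_iff:
  assumes "fps_nth u 0 = 1"
  shows "P = qmult q Q (elem_factor q \<mu> c u) \<longleftrightarrow>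
           qmult q P (mult_op (fps_to_fls u)) = qmult q Q (qlinear \<mu> c)"
proof -
  have u: "fps_to_fls u \<noteq> 0" using assms by auto
  have 1: "qmult q (mult_op (fps_to_fls u)) (mult_op (inverse (fps_to_fls u))) = 1"
    "qmult q (mult_op (inverse (fps_to_fls u))) (mult_op (fps_to_fls u)) = 1"
    using u by (simp_all add: mult_op_mult[OF q] mult_op_1)
  show ?thesis
  proof
    assume "P = qmult q Q (elem_factor q \<mu> c u)"
    then have "qmult q P (mult_op (fps_to_fls u)) = qmult q Q (qmult q (qlinear \<mu> c)
        (qmult q (mult_op (inverse (fps_to_fls u))) (mult_op (fps_to_fls u))))"
      by (simp only: elem_factor_eq qmult_assoc[OF q])
    then show "qmult q P (mult_op (fps_to_fls u)) = qmult q Q (qlinear \<mu> c)"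
      by (simp only: 1 qmult_1[OF q])
  next
    assume eq: "qmult q P (mult_op (fps_to_fls u)) = qmult q Q (qlinear \<mu> c)"
    have "P = qmult q P (qmult q (mult_op (fps_to_fls u)) (mult_op (inverse (fps_to_fls u))))"
      by (simp only: 1 qmult_1[OF q])
    also have "\<dots> = qmult q Q (elem_factor q \<mu> c u)"
      by (simp only: qmult_assoc[OF q, symmetric] eq elem_factor_eq)
    finally show "P = qmult q Q (elem_factor q \<mu> c u)" .
  qed
qed

lemma qmult_elem_factor:
  assumes "Q \<noteq> 0" "fps_nth u 0 = 1"
  shows "qmult q Q (elem_factor q \<mu> c u) \<noteq> 0"
    and "q_char_poly q \<mu> (qmult q Q (elem_factor q \<mu> c u)) = q_char_poly q \<mu> Q * laurent_linear c"
proof -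
  define P where "P = qmult q Q (elem_factor q \<mu> c u)"
  have P: "qmult q P (mult_op (fps_to_fls u)) = qmult q Q (qlinear \<mu> c)"
    using eq_qmult_elem_factor_iff[OF assms(2)] P_def by blast
  then show nz: "qmult q Q (elem_factor q \<mu> c u) \<noteq> 0"
    using qmult_qlinear_nonzero[OF q assms(1), of \<mu> c] by (auto simp: P_def)
  show "q_char_poly q \<mu> (qmult q Q (elem_factor q \<mu> c u)) = q_char_poly q \<mu> Q * laurent_linear c"
    using q_char_poly_qmult_fps[OF q nz assms(2), where \<mu> = \<mu>]
      q_char_poly_qmult_qlinear[OF q assms(1), where \<mu> = \<mu>]
    by (simp add: P[unfolded P_def])
qed

lemma right_elem_factor_exists_unique:
  assumes P: "P \<noteq> 0" and c: "c \<noteq> 0" "leval c (q_char_poly q \<mu> P) = 0"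
    and nonres: "\<And>n. 1 \<le> n \<Longrightarrow> leval (q ^ n * c) (q_char_poly q \<mu> P) \<noteq> 0"
  shows "\<exists>u Q. fps_nth u 0 = 1 \<and> P = qmult q Q (elem_factor q \<mu> c u)"
    and "fps_nth u 0 = 1 \<Longrightarrow> fps_nth u' 0 = 1 \<Longrightarrow> P = qmult q Q (elem_factor q \<mu> c u) \<Longrightarrow>
           P = qmult q Q' (elem_factor q \<mu> c u') \<Longrightarrow> u = u' \<and> Q = Q'"
proof -
  obtain l where l: "zcoeff q \<mu> P l \<noteq> 0" "\<And>k. k < l \<Longrightarrow> zcoeff q \<mu> P k = 0"
    using zcoeff_least_index[OF q P] by blast
  have chi: "q_char_poly q \<mu> P = zcoeff q \<mu> P l"
    using q_char_poly_eq_zcoeff[OF q l] .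
  \<comment> \<open>The coefficient of u_j in the remainder at order \<open>l + n\<close>; on the
    diagonal it is chi(q^n c).\<close>
  define B where "B = (\<lambda>n j. leval (q ^ j * c) (zcoeff q \<mu> P (l + int (n - j))))"
  have B: "B n n \<noteq> 0" if "1 \<le> n" for n
    using nonres[OF that] by (simp add: B_def chi)
  have remainder: "fls_nth (qremainder q \<mu> c (qmult q P (mult_op (fps_to_fls u)))) (l + int n) =
      (\<Sum>j\<le>n. fps_nth u j * B n j)" for u n
    unfolding fls_nth_qremainder B_def by (rule leval_zcoeff_qmult_fps[OF l(2)])
  obtain v where v: "v 0 = 1" "\<And>n. 1 \<le> n \<Longrightarrow> (\<Sum>j\<le>n. v j * B n j) = 0"
    using exists_triangular_solution[of B, OF B] by blast
  define w where "w = Abs_fps v"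
  have "qremainder q \<mu> c (qmult q P (mult_op (fps_to_fls w))) = 0"
  proof (rule fls_eqI)
    fix k
    show "fls_nth (qremainder q \<mu> c (qmult q P (mult_op (fps_to_fls w)))) k = fls_nth 0 k"
    proof (cases "k < l")
      case True
      then show ?thesis
        by (simp add: fls_nth_qremainder lookup_zcoeff_qmult_fps(2)[OF q l(2)])
    next
      case False
      then obtain n where n: "k = l + int n" using zle_iff_zadd[of l k] by auto
      \<comment> \<open>For \<open>n = 0\<close> the sum is chi(c), which vanishes by
        assumption.\<close>
      have "(\<Sum>j\<le>n. v j * B n j) = 0"
        using v c(2) by (cases "n = 0") (auto simp: B_def chi)
      then show ?thesis by (simp add: n remainder w_def)
    qed
  qed
  then obtain Q0 where "qmult q P (mult_op (fps_to_fls w)) = qmult q Q0 (qlinear \<mu> c)"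
    using qmult_qlinear_division[OF q c(1), of "qmult q P (mult_op (fps_to_fls w))" \<mu>]
    by (auto simp: mult_op_def)
  moreover have "fps_nth w 0 = 1" by (simp add: w_def v)
  ultimately show "\<exists>u Q. fps_nth u 0 = 1 \<and> P = qmult q Q (elem_factor q \<mu> c u)"
    using eq_qmult_elem_factor_iff by blast
  show "u = u' \<and> Q = Q'"
    if u: "fps_nth u 0 = 1" "fps_nth u' 0 = 1"
      and PQ: "P = qmult q Q (elem_factor q \<mu> c u)" "P = qmult q Q' (elem_factor q \<mu> c u')"
  proof -
    have eqs: "qmult q P (mult_op (fps_to_fls u)) = qmult q Q (qlinear \<mu> c)"
      "qmult q P (mult_op (fps_to_fls u')) = qmult q Q' (qlinear \<mu> c)"
      using PQ eq_qmult_elem_factor_iff[OF u(1), of P Q c] eq_qmult_elem_factor_iff[OF u(2), of P Q' c]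
      by blast+
    have "(\<Sum>j\<le>n. fps_nth u j * B n j) = (\<Sum>j\<le>n. fps_nth u' j * B n j)" for n
      unfolding remainder[symmetric] eqs qremainder_qmult_qlinear[OF q c(1)] ..
    then have "fps_nth u n = fps_nth u' n" for n
      using triangular_solution_unique[where B = B and u = "fps_nth u" and v = "fps_nth u'"] B u
      by simp
    then have "u = u'" by (rule fps_ext)
    \<comment> \<open>Once \<open>u\<close> is known, \<open>Q\<close> is determined by right
      cancellation of tau - c.\<close>
    moreover from this have "Q = Q'"
      using eqs by (intro qmult_qlinear_cancel[OF q, of Q \<mu> c Q']) simp
    ultimately show "u = u' \<and> Q = Q'" by blast
  qed
qed

section \<open>Products of several elementary factors\<close>

lemma qprod_list_append:
  "qprod_list q (Ps @ Qs) = qmult q (qprod_list q Ps) (qprod_list q Qs)"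
  by (induction Ps) (auto simp: qprod_list_def qmult_1 qmult_assoc q)

text \<open>\<open>foldr\<close> opens a product at its left end, whereas factors are split off at
  the right; carrying \<open>P\<close> in front permits induction from the right.\<close>

lemma qprod_list_snoc: "qmult q P (qprod_list q (Ps @ [Q])) = qmult q (qmult q P (qprod_list q Ps)) Q"
  by (simp add: qprod_list_append qmult_assoc q) (simp add: qprod_list_def qmult_1 q)

lemma qprod_list_Nil: "qmult q P (qprod_list q []) = P"
  by (simp add: qprod_list_def qmult_1 q)

lemma qprod_list_concat: "qprod_list q (concat Pss) = qprod_list q (map (qprod_list q) Pss)"
proof (induction Pss)
  case (Cons Ps Pss)
  have "qprod_list q (map (qprod_list q) (Ps # Pss)) =
      qmult q (qprod_list q Ps) (qprod_list q (map (qprod_list q) Pss))"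
    by (simp add: qprod_list_def)
  then show ?case using Cons by (simp add: qprod_list_append)
qed simp

text \<open>The list \<open>xs\<close> holds positions, not exponents: positions are distinct even
  where \<open>c\<close> repeats a value, so the product over \<open>set xs\<close> counts
  multiplicities.\<close>

lemma qmult_elem_factors:
  assumes "Q \<noteq> 0" "distinct xs" "\<And>k. k \<in> set xs \<Longrightarrow> fps_nth (u k) 0 = 1"
  shows "qmult q Q (qprod_list q (map (\<lambda>k. elem_factor q \<mu> (c k) (u k)) xs)) \<noteq> 0"
    and "q_char_poly q \<mu> (qmult q Q (qprod_list q (map (\<lambda>k. elem_factor q \<mu> (c k) (u k)) xs))) =
           q_char_poly q \<mu> Q * (\<Prod>k\<in>set xs. laurent_linear (c k))"
proof -
  have "qmult q Q (qprod_list q (map (\<lambda>k. elem_factor q \<mu> (c k) (u k)) xs)) \<noteq> 0 \<and>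
    q_char_poly q \<mu> (qmult q Q (qprod_list q (map (\<lambda>k. elem_factor q \<mu> (c k) (u k)) xs))) =
           q_char_poly q \<mu> Q * (\<Prod>k\<in>set xs. laurent_linear (c k))"
    using assms(2,3)
  proof (induction xs rule: rev_induct)
    case Nil
    then show ?case using assms(1) by (simp add: qprod_list_Nil)
  next
    case (snoc x xs)
    then show ?case by (simp add: qprod_list_snoc qmult_elem_factor mult_ac)
  qed
  then show "qmult q Q (qprod_list q (map (\<lambda>k. elem_factor q \<mu> (c k) (u k)) xs)) \<noteq> 0"
    and "q_char_poly q \<mu> (qmult q Q (qprod_list q (map (\<lambda>k. elem_factor q \<mu> (c k) (u k)) xs))) =
           q_char_poly q \<mu> Q * (\<Prod>k\<in>set xs. laurent_linear (c k))"
    by auto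
qed

text \<open>The last factor is split off first. If its value is c, the sorting hypothesis keeps the
  values further left away from all q^n c with n >= 1; the factor itself, which
  \<open>sorted_wrt\<close> does not compare with itself, is covered by
  \<open>c k \<noteq> q ^ n * c k\<close>, and the rest of chi by the condition on \<open>g\<close>.
  All of this passes to the cofactor with the same \<open>g\<close>.\<close>

lemma right_elem_factors_exist_unique:
  fixes c :: "'k \<Rightarrow> complex"
  assumes "P \<noteq> 0" "distinct xs" "\<And>k. k \<in> set xs \<Longrightarrow> c k \<noteq> 0"
    and "q_char_poly q \<mu> P = g * (\<Prod>k\<in>set xs. laurent_linear (c k))"
    and "\<And>k n. k \<in> set xs \<Longrightarrow> 1 \<le> n \<Longrightarrow> leval (q ^ n * c k) g \<noteq> 0 \<and> c k \<noteq> q ^ n * c k"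
    and "sorted_wrt (\<lambda>k k'. \<forall>n\<ge>1. c k \<noteq> q ^ n * c k') xs"
  shows "\<exists>u Q. (\<forall>k\<in>set xs. fps_nth (u k) 0 = 1) \<and>
           P = qmult q Q (qprod_list q (map (\<lambda>k. elem_factor q \<mu> (c k) (u k)) xs))" (is ?ex)
    and "\<forall>k\<in>set xs. fps_nth (u k) 0 = 1 \<Longrightarrow> \<forall>k\<in>set xs. fps_nth (u' k) 0 = 1 \<Longrightarrow>
      P = qmult q Q (qprod_list q (map (\<lambda>k. elem_factor q \<mu> (c k) (u k)) xs)) \<Longrightarrow>
      P = qmult q Q' (qprod_list q (map (\<lambda>k. elem_factor q \<mu> (c k) (u' k)) xs)) \<Longrightarrow>
      Q = Q' \<and> (\<forall>k\<in>set xs. u k = u' k)"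
proof -
  have main: "?ex \<and> (\<forall>u u' Q Q'. (\<forall>k\<in>set xs. fps_nth (u k) 0 = 1) \<longrightarrow> (\<forall>k\<in>set xs. fps_nth (u' k) 0 = 1) \<longrightarrow>
      P = qmult q Q (qprod_list q (map (\<lambda>k. elem_factor q \<mu> (c k) (u k)) xs)) \<longrightarrow>
      P = qmult q Q' (qprod_list q (map (\<lambda>k. elem_factor q \<mu> (c k) (u' k)) xs)) \<longrightarrow>
      Q = Q' \<and> (\<forall>k\<in>set xs. u k = u' k))"
    using assms
  proof (induction xs arbitrary: P rule: rev_induct)
    case Nil
    then show ?case by (auto simp: qprod_list_Nil)
  next
    case (snoc x xs)
    let ?w = "\<lambda>u xs. qprod_list q (map (\<lambda>k. elem_factor q \<mu> (c k) (u k)) xs)"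
    have chi: "q_char_poly q \<mu> P = g * (\<Prod>k\<in>set xs. laurent_linear (c k)) * laurent_linear (c x)"
      using snoc.prems(2,4) by (simp add: mult_ac)
    have lev: "leval s (g * (\<Prod>k\<in>set ys. laurent_linear (c k))) =
        leval s g * (\<Prod>k\<in>set ys. s - c k)" if "s \<noteq> 0" for s ys
    proof -
      have "leval s (\<Prod>k\<in>A. laurent_linear (c k)) = (\<Prod>k\<in>A. s - c k)" if "finite A" for A
        using that \<open>s \<noteq> 0\<close>
        by (induction A rule: finite_induct)
           (auto simp: leval_mult simp flip: single_one)
      then show ?thesis using that by (simp add: leval_mult)
    qed
    have cx: "c x \<noteq> 0" using snoc.prems(3) by simp
    have root: "leval (c x) (q_char_poly q \<mu> P) = 0"
      unfolding chi using cx by (simp add: leval_mult)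
    have nonroot: "leval (q ^ n * c x) (q_char_poly q \<mu> P) \<noteq> 0" if n: "1 \<le> n" for n
    proof -
      have "q ^ n * c x \<noteq> c k" if "k \<in> set (xs @ [x])" for k
      proof (cases "k = x")
        case True
        then show ?thesis using snoc.prems(5)[of x n] n by auto
      next
        case False
        then have "c k \<noteq> q ^ n * c x" using snoc.prems(6) that n by (simp add: sorted_wrt_append)
        then show ?thesis by simp
      qed
      then show ?thesis
        using lev[of "q ^ n * c x" "xs @ [x]"] snoc.prems(4) snoc.prems(5)[of x n] n q cx
        by auto
    qed
    note one = right_elem_factor_exists_unique[OF snoc.prems(1) cx root nonroot]
    have IH: "(\<exists>u Q'. (\<forall>k\<in>set xs. fps_nth (u k) 0 = 1) \<and> Q = qmult q Q' (?w u xs)) \<and>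
      (\<forall>u u' Q1 Q2. (\<forall>k\<in>set xs. fps_nth (u k) 0 = 1) \<longrightarrow> (\<forall>k\<in>set xs. fps_nth (u' k) 0 = 1) \<longrightarrow>
      Q = qmult q Q1 (?w u xs) \<longrightarrow> Q = qmult q Q2 (?w u' xs) \<longrightarrow> Q1 = Q2 \<and> (\<forall>k\<in>set xs. u k = u' k))"
      if Q: "P = qmult q Q (elem_factor q \<mu> (c x) v)" "fps_nth v 0 = 1" for Q v
    proof -
      have nz: "Q \<noteq> 0" using Q snoc.prems(1) by auto
      have "q_char_poly q \<mu> Q * laurent_linear (c x) =
          g * (\<Prod>k\<in>set xs. laurent_linear (c k)) * laurent_linear (c x)"
        using qmult_elem_factor(2)[OF nz Q(2), of "c x"] Q(1) chi by simp
      then have "q_char_poly q \<mu> Q = g * (\<Prod>k\<in>set xs. laurent_linear (c k))"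
        by simp
      then show ?thesis
        using snoc.prems nz by (intro snoc.IH) (auto simp: sorted_wrt_append)
    qed
    show ?case
    proof (intro conjI allI impI)
      obtain v Q where v: "fps_nth v 0 = 1" and Q: "P = qmult q Q (elem_factor q \<mu> (c x) v)"
        using one(1) by blast
      obtain u Q' where u: "\<forall>k\<in>set xs. fps_nth (u k) 0 = 1" "Q = qmult q Q' (?w u xs)"
        using IH[OF Q v] by blast
      \<comment> \<open>Distinctness keeps \<open>x\<close> out of \<open>xs\<close>, so the update
        leaves these factors alone.\<close>
      have "?w (u(x := v)) xs = ?w u xs"
        using snoc.prems(2) by (intro arg_cong[where f = "qprod_list q"] map_cong) auto
      then have "qmult q Q' (?w (u(x := v)) (xs @ [x])) = qmult q Q (elem_factor q \<mu> (c x) v)"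
        by (simp only: map_append list.map qprod_list_snoc fun_upd_same u(2))
      then have "P = qmult q Q' (?w (u(x := v)) (xs @ [x]))" using Q by (simp only:)
      moreover have "\<forall>k\<in>set (xs @ [x]). fps_nth ((u(x := v)) k) 0 = 1"
        using u(1) v by auto
      ultimately show "\<exists>u Q. (\<forall>k\<in>set (xs @ [x]). fps_nth (u k) 0 = 1) \<and> P = qmult q Q (?w u (xs @ [x]))"
        by blast
    next
      fix u u' Q Q'
      assume u: "\<forall>k\<in>set (xs @ [x]). fps_nth (u k) 0 = 1" "\<forall>k\<in>set (xs @ [x]). fps_nth (u' k) 0 = 1"
        and "P = qmult q Q (?w u (xs @ [x]))" "P = qmult q Q' (?w u' (xs @ [x]))"
      then have PQ: "P = qmult q (qmult q Q (?w u xs)) (elem_factor q \<mu> (c x) (u x))"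
        "P = qmult q (qmult q Q' (?w u' xs)) (elem_factor q \<mu> (c x) (u' x))"
        by (simp_all add: qprod_list_snoc)
      then have x: "u x = u' x" "qmult q Q (?w u xs) = qmult q Q' (?w u' xs)"
        using one(2)[OF _ _ _ PQ] u by auto
      have "fps_nth (u x) 0 = 1" and u': "\<forall>k\<in>set xs. fps_nth (u k) 0 = 1" "\<forall>k\<in>set xs. fps_nth (u' k) 0 = 1"
        using u by auto
      have "Q = Q' \<and> (\<forall>k\<in>set xs. u k = u' k)"
        by (rule conjunct2[OF IH[OF PQ(1) \<open>fps_nth (u x) 0 = 1\<close>], THEN spec, THEN spec, THEN spec, THEN spec,
              THEN mp, THEN mp, THEN mp, THEN mp, OF u' refl x(2)])
      then show "Q = Q'" "\<forall>k\<in>set (xs @ [x]). u k = u' k" using x(1) by auto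
    qed
  qed
  show ?ex by (rule conjunct1[OF main])
  show "\<forall>k\<in>set xs. fps_nth (u k) 0 = 1 \<Longrightarrow> \<forall>k\<in>set xs. fps_nth (u' k) 0 = 1 \<Longrightarrow>
      P = qmult q Q (qprod_list q (map (\<lambda>k. elem_factor q \<mu> (c k) (u k)) xs)) \<Longrightarrow>
      P = qmult q Q' (qprod_list q (map (\<lambda>k. elem_factor q \<mu> (c k) (u' k)) xs)) \<Longrightarrow>
      Q = Q' \<and> (\<forall>k\<in>set xs. u k = u' k)"
    by (rule conjunct2[OF main, THEN spec, THEN spec, THEN spec, THEN spec,
          THEN mp, THEN mp, THEN mp, THEN mp])
qed

end


section \<open>Newton polygons with a single slope\<close>

text \<open>The half-strip is convex and contains all generating points. Conversely, each of its
  points is a convex combination of points above the two end vertices, where the line of slope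
  \<open>\<mu>\<close> is attained.\<close>

lemma newton_polygon_single_slope:
  fixes n :: nat
  assumes keys: "Poly_Mapping.keys R \<subseteq> {0..int n}" "0 \<in> Poly_Mapping.keys R" "int n \<in> Poly_Mapping.keys R"
    and above: "\<And>i. i \<in> Poly_Mapping.keys R \<Longrightarrow> \<mu> * i \<le> fls_subdegree (Poly_Mapping.lookup R i)"
    and ends: "fls_subdegree (Poly_Mapping.lookup R 0) = 0"
      "fls_subdegree (Poly_Mapping.lookup R (int n)) = \<mu> * int n"
  shows "newton_polygon R = {(x, y). 0 \<le> x \<and> x \<le> real n \<and> of_int \<mu> * x \<le> y}" (is "_ = ?N")
proof
  have "convex ?N"
  proof (rule convexI)
    fix v w :: "real \<times> real" and s t :: real
    assume vw: "v \<in> ?N" "w \<in> ?N" and st: "0 \<le> s" "0 \<le> t" "s + t = 1"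
    obtain x y x' y' where eq: "v = (x, y)" "w = (x', y')" by (cases v, cases w)
    have "s * (of_int \<mu> * x) + t * (of_int \<mu> * x') \<le> s * y + t * y'"
      using vw st by (intro add_mono mult_left_mono) (auto simp: eq)
    then have "of_int \<mu> * (s * x + t * x') \<le> s * y + t * y'"
      by (simp add: algebra_simps)
    moreover have "s * x + t * x' \<le> real n"
      using vw st by (intro convex_bound_le) (auto simp: eq)
    ultimately show "s *\<^sub>R v + t *\<^sub>R w \<in> ?N" using vw st by (simp add: eq)
  qed
  moreover have "(of_int i, of_int j) \<in> ?N"
    if "i \<in> Poly_Mapping.keys R" "fls_subdegree (Poly_Mapping.lookup R i) \<le> j" for i j :: int
  proof -
    have "0 \<le> i" "i \<le> int n" using keys(1) that(1) by auto
    moreover have "\<mu> * i \<le> j" using above[OF that(1)] that(2) by simp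
    then have "of_int \<mu> * of_int i \<le> (of_int j :: real)" by (metis of_int_le_iff of_int_mult)
    ultimately show ?thesis by simp
  qed
  ultimately show "newton_polygon R \<subseteq> ?N"
    unfolding newton_polygon_def by (intro hull_minimal) auto
  show "?N \<subseteq> newton_polygon R"
  proof clarify
    fix x y :: real
    assume x: "0 \<le> x" "x \<le> real n" and y: "of_int \<mu> * x \<le> y"
    define t where "t = y - of_int \<mu> * x"
    have t: "0 \<le> t" "y = of_int \<mu> * x + t" using y by (auto simp: t_def)
    have cvx: "convex (newton_polygon R)" by (simp add: newton_polygon_def)
    have pt: "(of_int i, of_int j) \<in> newton_polygon R"
      if "i \<in> Poly_Mapping.keys R" "fls_subdegree (Poly_Mapping.lookup R i) \<le> j" for i j :: int
      unfolding newton_polygon_def using that by (intro hull_inc) auto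
    have up: "(of_int i, of_int (\<mu> * i) + t) \<in> newton_polygon R"
      if i: "i \<in> Poly_Mapping.keys R" "fls_subdegree (Poly_Mapping.lookup R i) = \<mu> * i" for i
    proof -
      \<comment> \<open>Generating points have integer heights, so a real height \<open>t\<close>
        above a vertex is interpolated between 0 and an integer \<open>J\<close>; adding 1 keeps
        \<open>J\<close> positive when \<open>t = 0\<close>.\<close>
      define J where "J = \<lceil>t\<rceil> + 1"
      have J: "t \<le> of_int J" "0 < J" using t(1) by (auto simp: J_def) linarith+
      have "(1 - t / of_int J) *\<^sub>R (of_int i, of_int (\<mu> * i)) +
          (t / of_int J) *\<^sub>R (of_int i, of_int (\<mu> * i + J)) \<in> newton_polygon R"
        using i J t(1) by (intro convexD[OF cvx] pt) auto
      moreover have "(1 - t / of_int J) *\<^sub>R (of_int i, of_int (\<mu> * i)) +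
          (t / of_int J) *\<^sub>R (of_int i, of_int (\<mu> * i + J)) = ((of_int i, of_int (\<mu> * i) + t) :: real \<times> real)"
        using J by (simp add: field_simps)
      ultimately show ?thesis by simp
    qed
    show "(x, y) \<in> newton_polygon R"
    proof (cases "n = 0")
      case True
      then show ?thesis using up[of 0] keys(2) ends(1) x t(2) by simp
    next
      case False
      have "(1 - x / n) *\<^sub>R (of_int 0, of_int (\<mu> * 0) + t) +
          (x / n) *\<^sub>R (of_int (int n), of_int (\<mu> * int n) + t) \<in> newton_polygon R"
        using x False keys ends by (intro convexD[OF cvx] up) (auto simp: divide_simps)
      moreover have "(1 - x / n) *\<^sub>R (of_int 0, of_int (\<mu> * 0) + t) +
          (x / n) *\<^sub>R (of_int (int n), of_int (\<mu> * int n) + t) = (x, y)"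
        using False t(2) by (simp add: field_simps)
      ultimately show ?thesis by simp
    qed
  qed
qed

lemma newton_vectors_single_slope:
  fixes n :: nat
  assumes N: "newton_polygon R = {(x, y). 0 \<le> x \<and> x \<le> real n \<and> of_int \<mu> * x \<le> y}"
  shows "newton_vectors R = (if n = 0 then {} else {(n, \<mu> * int n)})"
proof -
  have "n > 0 \<and> r = n \<and> d = \<mu> * int n"
    if r: "0 < r" and edge: "closed_segment (x, y) (x + real r, y + of_int d) edge_of newton_polygon R"
    for r d x y
  proof -
    define S where "S = closed_segment (x, y) (x + real r, y + of_int d)"
    have face: "S face_of newton_polygon R" using edge by (simp add: edge_of_def S_def)
    have in_S: "v \<in> S \<longleftrightarrow> (\<exists>u. 0 \<le> u \<and> u \<le> 1 \<and> v = (x + u * real r, y + u * of_int d))" for v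
      by (auto simp: S_def in_segment algebra_simps)
    have "(x, y) \<in> S" "(x + real r, y + of_int d) \<in> S" by (auto simp: S_def)
    then have "(x, y) \<in> newton_polygon R" "(x + real r, y + of_int d) \<in> newton_polygon R"
      using face_of_imp_subset[OF face] by auto
    then have b: "0 \<le> x" "x + real r \<le> real n" "of_int \<mu> * x \<le> y"
      "of_int \<mu> * (x + real r) \<le> y + of_int d" by (auto simp: N)
    define M1 M2 where "M1 = x + real r / 2" and "M2 = y + of_int d / 2"
    have MS: "(M1, M2) \<in> S" unfolding in_S by (intro exI[of _ "1/2"]) (auto simp: M1_def M2_def)
    have M1: "0 < M1" "M1 < real n" using b r by (auto simp: M1_def)
    have "of_int \<mu> * M1 \<le> M2"
      using b by (simp add: M1_def M2_def algebra_simps)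
    have "M2 = of_int \<mu> * M1"
    proof (rule ccontr)
      assume "M2 \<noteq> of_int \<mu> * M1"
      \<comment> \<open>Above the bottom line there is room for a vertical segment around the
        midpoint of the edge. The face would contain it, but an edge with \<open>0 < r\<close> is
        not vertical.\<close>
      define e where "e = M2 - of_int \<mu> * M1"
      have e: "e > 0" using \<open>M2 \<noteq> of_int \<mu> * M1\<close> \<open>of_int \<mu> * M1 \<le> M2\<close> by (simp add: e_def)
      have "(M1, M2) \<in> open_segment (M1, M2 - e) (M1, M2 + e)"
        unfolding in_segment using e by (auto intro!: exI[of _ "1/2"] simp: algebra_simps)
      moreover have "of_int \<mu> * M1 \<le> M2 - e" "of_int \<mu> * M1 \<le> M2 + e"
        using e unfolding e_def by linarith+
      then have "(M1, M2 - e) \<in> newton_polygon R" "(M1, M2 + e) \<in> newton_polygon R"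
        using M1 by (simp_all add: N)
      ultimately have "(M1, M2 + e) \<in> S" using face_ofD[OF face] MS by blast
      then obtain u where u: "M1 = x + u * real r" "M2 + e = y + u * of_int d" by (auto simp: in_S)
      then have half: "u = 1 / 2" using r by (simp add: M1_def)
      show False using u(2) e unfolding half M2_def by simp
    qed
    \<comment> \<open>The midpoint is interior to the bottom side, so the face property puts both
      end vertices into \<open>S\<close>.\<close>
    have "(M1, M2) \<in> open_segment (0, 0) (real n, of_int \<mu> * real n)"
      unfolding in_segment using M1 \<open>M2 = of_int \<mu> * M1\<close>
      by (auto intro!: exI[of _ "M1 / real n"] simp: field_simps)
    moreover have "(0, 0) \<in> newton_polygon R" "(real n, of_int \<mu> * real n) \<in> newton_polygon R"
      by (auto simp: N)
    ultimately have *: "(0, 0) \<in> S" "(real n, of_int \<mu> * real n) \<in> S"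
      using face_ofD[OF face] MS by blast+
    from *(1) obtain u where u: "0 \<le> u" "0 = x + u * real r" "0 = y + u * of_int d" by (auto simp: in_S)
    have "0 \<le> u * real r" using u by simp
    then have "x = 0" "u * real r = 0" using u(2) b(1) by linarith+
    then have xy: "x = 0" "y = 0" using u r by auto
    from *(2) obtain w where w: "w \<le> 1" "real n = w * real r" "of_int \<mu> * real n = w * of_int d"
      by (auto simp: in_S xy)
    have "w * real r \<le> 1 * real r" using w(1) by (intro mult_right_mono) auto
    then have "real r = real n" using w(2) b(2) xy by linarith
    then have rn: "r = n" by simp
    then have "w = 1" using w(2) r by simp
    then have "of_int (\<mu> * int n) = (of_int d :: real)" using w(3) by simp
    then show ?thesis using rn r by (metis of_int_eq_iff)
  qed
  moreover have "closed_segment (0, 0) (0 + real n, 0 + of_int (\<mu> * int n)) edge_of newton_polygon R"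
    if n: "n > 0"
  proof -
    \<comment> \<open>The bottom side is cut out by the supporting line y = mu x.\<close>
    have "closed_segment (0, 0) (real n, of_int \<mu> * real n) =
        newton_polygon R \<inter> {v. (- of_int \<mu>, 1) \<bullet> v = (0::real)}"
    proof (intro equalityI subsetI)
      fix v assume "v \<in> closed_segment (0, 0) (real n, of_int \<mu> * real n)"
      then show "v \<in> newton_polygon R \<inter> {v. (- of_int \<mu>, 1) \<bullet> v = (0::real)}"
        by (auto simp: in_segment N inner_prod_def intro: mult_left_le_one_le)
    next
      fix v assume "v \<in> newton_polygon R \<inter> {v. (- of_int \<mu>, 1) \<bullet> v = (0::real)}"
      then obtain x where "0 \<le> x" "x \<le> real n" "v = (x, of_int \<mu> * x)"
        by (cases v) (auto simp: N inner_prod_def)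
      then show "v \<in> closed_segment (0, 0) (real n, of_int \<mu> * real n)"
        using n by (auto simp: in_segment intro!: exI[of _ "x / real n"])
    qed
    moreover have "convex (newton_polygon R)" by (simp add: newton_polygon_def)
    then have "newton_polygon R \<inter> {v. (- of_int \<mu>, 1) \<bullet> v = (0::real)} face_of newton_polygon R"
      by (rule face_of_Int_supporting_hyperplane_ge) (auto simp: N inner_prod_def)
    moreover have "aff_dim (closed_segment (0, 0) (real n, of_int \<mu> * real n)) = 1"
      using n by (simp add: segment_convex_hull aff_dim_convex_hull)
    ultimately show ?thesis by (simp add: edge_of_def)
  qed
  ultimately show ?thesis
    unfolding newton_vectors_def by (auto intro!: exI[of _ "0 :: real"])
qed

lemma newton_rank_single_slope:
  fixes n :: nat
  assumes "newton_polygon R = {(x, y). 0 \<le> x \<and> x \<le> real n \<and> of_int \<mu> * x \<le> y}"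
  shows "newton_rank R = (\<lambda>\<nu>. if \<nu> = of_int \<mu> then n else 0)"
  by (auto simp: newton_rank_def newton_vectors_single_slope[OF assms] fun_eq_iff)

section \<open>Support and rank of a product of elementary factors\<close>

lemma inverse_fps_to_fls:
  fixes u :: "complex fps"
  assumes "fps_nth u 0 \<noteq> 0"
  shows "inverse (fps_to_fls u) = fps_to_fls (inverse u)"
  using assms by (intro inverse_unique) (simp add: inverse_mult_eq_1' flip: fls_times_fps_to_fls)

context
  fixes q :: complex and \<mu> :: int
  assumes q: "q \<noteq> 0"
begin

text \<open>At order 0 in z the product reduces to the product of the X - c_k, whose leading and
  constant coefficients are nonzero. These, the support and the vanishing at negative orders are
  what the Newton polygon requires.\<close>

lemma qprod_list_elem_factors_coeffs:
  fixes c :: "'k \<Rightarrow> complex"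
  assumes "\<And>k. k \<in> set xs \<Longrightarrow> fps_nth (u k) 0 = 1 \<and> c k \<noteq> 0"
  defines "R \<equiv> qprod_list q (map (\<lambda>k. elem_factor q \<mu> (c k) (u k)) xs)"
  shows "Poly_Mapping.keys R \<subseteq> {0..int (length xs)} \<and> (\<forall>k<0. zcoeff q \<mu> R k = 0) \<and>
    Poly_Mapping.lookup (zcoeff q \<mu> R 0) 0 \<noteq> 0 \<and>
    Poly_Mapping.lookup (zcoeff q \<mu> R 0) (int (length xs)) \<noteq> 0"
  using assms(1) unfolding R_def
proof (induction xs rule: rev_induct)
  case Nil
  have "twisted_coeff q \<mu> 1 i = (if i = 0 then 1 else 0)" for i
    by (simp add: twisted_coeff_def lookup_one when_def)
  then have "Poly_Mapping.lookup (zcoeff q \<mu> 1 k) i = (if i = 0 \<and> k = 0 then 1 else 0)" for i k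
    by (simp add: lookup_zcoeff[OF q])
  then show ?case by (auto simp: qprod_list_def intro!: poly_mapping_eqI)
next
  case (snoc x xs)
  define R where "R = qprod_list q (map (\<lambda>k. elem_factor q \<mu> (c k) (u k)) xs)"
  define R1 where "R1 = qmult q R (qlinear \<mu> (c x))"
  define R2 where "R2 = qmult q R1 (mult_op (fps_to_fls (inverse (u x))))"
  have ux: "fps_nth (u x) 0 = 1" "c x \<noteq> 0" using snoc.prems by auto
  have R2: "qprod_list q (map (\<lambda>k. elem_factor q \<mu> (c k) (u k)) (xs @ [x])) = R2"
    using qprod_list_snoc[OF q, of 1] ux
    by (simp add: R2_def R1_def R_def elem_factor_eq[OF q] qmult_1 q qmult_assoc inverse_fps_to_fls)
  have IH: "Poly_Mapping.keys R \<subseteq> {0..int (length xs)}" "\<And>k. k < 0 \<Longrightarrow> zcoeff q \<mu> R k = 0"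
    "Poly_Mapping.lookup (zcoeff q \<mu> R 0) 0 \<noteq> 0"
    "Poly_Mapping.lookup (zcoeff q \<mu> R 0) (int (length xs)) \<noteq> 0"
    using snoc by (auto simp: R_def)
  \<comment> \<open>Because coefficients vanish beyond the ends, multiplication by X - c keeps the
    top coefficient and multiplies the constant one by -c.\<close>
  have zR: "Poly_Mapping.lookup (zcoeff q \<mu> R k) i = 0" if "i < 0 \<or> i > int (length xs)" for i k
  proof -
    have "i \<notin> Poly_Mapping.keys R" using IH(1) that by auto
    then show ?thesis using keys_zcoeff_subset[OF q] by (meson in_keys_iff subsetD)
  qed
  have R1_neg: "zcoeff q \<mu> R1 k = 0" if "k < 0" for k
    using IH(2)[OF that] by (simp add: R1_def zcoeff_qmult_qlinear[OF q])
  have R2_0: "zcoeff q \<mu> R2 0 = zcoeff q \<mu> R1 0"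
    unfolding R2_def by (rule poly_mapping_eqI)
      (use lookup_zcoeff_qmult_fps(1)[OF q R1_neg, where n = 0] ux in simp)
  have "Poly_Mapping.keys R2 \<subseteq> {0..int (length (xs @ [x]))}"
  proof
    fix i assume "i \<in> Poly_Mapping.keys R2"
    then have "twisted_coeff q \<mu> R2 i \<noteq> 0" by (simp add: twisted_coeff_eq_0_iff[OF q])
    then have "twisted_coeff q \<mu> R (i - 1) \<noteq> 0 \<or> twisted_coeff q \<mu> R i \<noteq> 0"
      by (auto simp: R2_def R1_def twisted_coeff_qmult_mult_op[OF q] twisted_coeff_qmult_qlinear[OF q])
    then have "i - 1 \<in> Poly_Mapping.keys R \<or> i \<in> Poly_Mapping.keys R"
      by (simp add: twisted_coeff_eq_0_iff[OF q])
    then show "i \<in> {0..int (length (xs @ [x]))}" using IH(1) by auto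
  qed
  moreover have "zcoeff q \<mu> R2 k = 0" if "k < 0" for k
    unfolding R2_def using lookup_zcoeff_qmult_fps(2)[OF q R1_neg that] .
  moreover have "Poly_Mapping.lookup (zcoeff q \<mu> R2 0) 0 \<noteq> 0"
    using IH(3) ux zR[of "-1" 0]
    by (simp add: R2_0 R1_def zcoeff_qmult_qlinear[OF q] lookup_mult_laurent_linear)
  moreover have "Poly_Mapping.lookup (zcoeff q \<mu> R2 0) (int (length (xs @ [x]))) \<noteq> 0"
    using IH(4) zR[of "1 + int (length xs)" 0]
    by (simp add: R2_0 R1_def zcoeff_qmult_qlinear[OF q] lookup_mult_laurent_linear)
  ultimately show ?case unfolding R2 by blast
qed

lemma newton_rank_qprod_list_elem_factors:
  fixes c :: "'k \<Rightarrow> complex"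
  assumes "\<And>k. k \<in> set xs \<Longrightarrow> fps_nth (u k) 0 = 1 \<and> c k \<noteq> 0"
  shows "newton_rank (qprod_list q (map (\<lambda>k. elem_factor q \<mu> (c k) (u k)) xs)) =
           (\<lambda>\<nu>. if \<nu> = of_int \<mu> then length xs else 0)"
proof (rule newton_rank_single_slope, rule newton_polygon_single_slope)
  define R where "R = qprod_list q (map (\<lambda>k. elem_factor q \<mu> (c k) (u k)) xs)"
  note R = qprod_list_elem_factors_coeffs[of xs u c, OF assms, folded R_def]
  have sub: "fls_subdegree (twisted_coeff q \<mu> R i) = fls_subdegree (Poly_Mapping.lookup R i) - \<mu> * i"
    if "i \<in> Poly_Mapping.keys R" for i
  proof -
    have "Poly_Mapping.lookup R i * fls_const (q powi (- (\<mu> * (i * (i - 1) div 2)))) \<noteq> 0"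
      "fls_subdegree (Poly_Mapping.lookup R i * fls_const (q powi (- (\<mu> * (i * (i - 1) div 2))))) =
       fls_subdegree (Poly_Mapping.lookup R i)"
      using that q by (auto simp: in_keys_iff)
    then show ?thesis
      unfolding twisted_coeff_def by (subst fls_subdegree_mult_fls_X_intpow(2)) auto
  qed
  have neg: "fls_nth (twisted_coeff q \<mu> R i) k = 0" if "k < 0" for i k
    using R that lookup_zcoeff[OF q, of \<mu> R k i] by simp
  have zero: "i \<in> Poly_Mapping.keys R \<and> fls_subdegree (twisted_coeff q \<mu> R i) = 0"
    if "Poly_Mapping.lookup (zcoeff q \<mu> R 0) i \<noteq> 0" for i
  proof -
    have "fls_nth (twisted_coeff q \<mu> R i) 0 \<noteq> 0" using that by (simp add: lookup_zcoeff[OF q])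
    then show ?thesis
      using neg twisted_coeff_eq_0_iff[OF q, of \<mu> R i] by (auto intro: fls_subdegree_eqI)
  qed
  show "Poly_Mapping.keys R \<subseteq> {0..int (length xs)}" using R by blast
  show "0 \<in> Poly_Mapping.keys R" "int (length xs) \<in> Poly_Mapping.keys R"
    using R zero by blast+
  show "fls_subdegree (Poly_Mapping.lookup R 0) = 0"
    "fls_subdegree (Poly_Mapping.lookup R (int (length xs))) = \<mu> * int (length xs)"
    using R zero[of 0] zero[of "int (length xs)"] sub[of 0] sub[of "int (length xs)"] by auto
  show "\<mu> * i \<le> fls_subdegree (Poly_Mapping.lookup R i)" if "i \<in> Poly_Mapping.keys R" for i
    using sub[OF that] fls_subdegree_ge0I[of "twisted_coeff q \<mu> R i"] neg by force
qed

end


section \<open>The factorization\<close>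

text \<open>The normalized part of \<open>d\<close> is unchanged. This is how the ordering by
  epsilon excludes equalities c = q^n c' with n >= 1.\<close>

lemma q_epsilon_power_mult:
  assumes "norm q > 1" "d \<noteq> 0"
  shows "q_epsilon q (q ^ n * d) = int n + q_epsilon q d"
proof -
  have q: "q \<noteq> 0" using assms by auto
  obtain e where e: "d = q powi q_epsilon q d * e" "1 \<le> norm e" "norm e < norm q"
    using theI'[OF q_epsilon_unique[OF assms]] unfolding q_epsilon_def by blast
  have "q ^ n * d = q powi (int n + q_epsilon q d) * e"
    by (subst e(1)) (use q in \<open>simp add: power_int_add mult.assoc\<close>)
  then show ?thesis
    unfolding q_epsilon_def[of q "q ^ n * d"]
    using assms(2) q e(2,3)
    by (intro the1_equality[OF q_epsilon_unique[OF assms(1)]] exI[of _ e]) auto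
qed

text \<open>The positions \<open>(i, j)\<close> of the elementary factors of \<open>R\<close>, read from left to right.\<close>

definition block_indices :: "(nat \<Rightarrow> nat) \<Rightarrow> nat \<Rightarrow> (nat \<times> nat) list" where
  "block_indices m p = concat (map (\<lambda>i. map (Pair i) (rev [1..<m i + 1])) [1..<p + 1])"

lemma set_block_indices: "set (block_indices m p) = (SIGMA i:{1..p}. {1..m i})"
  by (auto simp: block_indices_def image_iff simp del: upt_Suc)

lemma sorted_wrt_concat_map_Pair:
  fixes "is" :: "'a :: linorder list"
  assumes "sorted_wrt (<) is"
  shows "sorted_wrt (\<lambda>a b. fst a \<le> fst b) (concat (map (\<lambda>i. map (Pair i) (f i)) is))"
  using assms
  by (induction "is") (auto simp: sorted_wrt_append sorted_wrt_map intro: less_imp_le)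

lemma distinct_concat_map_Pair:
  assumes "distinct is" "\<And>i. i \<in> set is \<Longrightarrow> distinct (f i)"
  shows "distinct (concat (map (\<lambda>i. map (Pair i) (f i)) is))"
  using assms by (induction "is") (auto simp: distinct_map inj_on_def)

lemma distinct_block_indices: "distinct (block_indices m p)"
  unfolding block_indices_def by (rule distinct_concat_map_Pair) auto

lemma length_block_indices: "length (block_indices m p) = (\<Sum>i=1..p. m i)"
  by (simp add: distinct_card[OF distinct_block_indices, symmetric] set_block_indices card_SigmaI)

lemma prod_block_indices:
  "(\<Prod>k\<in>set (block_indices m p). f (fst k)) = (\<Prod>i=1..p. f i ^ m i)"
proof -
  have "(\<Prod>i=1..p. f i ^ m i) = (\<Prod>i\<in>{1..p}. \<Prod>j\<in>{1..m i}. f i)" by simp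
  also have "\<dots> = (\<Prod>(i, j)\<in>(SIGMA i:{1..p}. {1..m i}). f i)" by (rule prod.Sigma) auto
  finally show ?thesis by (simp add: set_block_indices case_prod_beta)
qed

text \<open>Both sides read the factors in the same order, \<open>j\<close> decreasing within a
  block, so only the nesting of products is flattened.\<close>

lemma qprod_list_block_factors:
  assumes "q \<noteq> 0"
  shows "qprod_list q (map (\<lambda>i. block_factor q \<mu> (c i) (m i) (u i)) [1..<p + 1]) =
    qprod_list q (map (\<lambda>k. elem_factor q \<mu> (c (fst k)) (u (fst k) (snd k))) (block_indices m p))"
  unfolding block_indices_def map_concat qprod_list_concat[OF assms]
  by (simp add: block_factor_def o_def rev_map)

theorem proposition2p5:
  fixes q a :: complex
    and K :: "complex fls set"
    and P :: qop
    and \<mu> :: int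
    and p :: nat
    and c :: "nat \<Rightarrow> complex"
    and m :: "nat \<Rightarrow> nat"
  assumes q: "norm q > 1"
    and K: "K \<in> {meromorphic_field, germ_field, UNIV}"
    and P: "P \<in> qops_over K" "P \<noteq> 0"
    and slope: "of_int \<mu> \<in> slopes P"
    and a: "a \<noteq> 0"
    and c: "bij_betw c {1..p} {d \<in> exponents q \<mu> P. cong_q q d a}"
    and eps: "\<And>i j. 1 \<le> i \<Longrightarrow> i < j \<Longrightarrow> j \<le> p \<Longrightarrow> q_epsilon q (c i) < q_epsilon q (c j)"
    and m: "\<And>i. 1 \<le> i \<Longrightarrow> i \<le> p \<Longrightarrow> m i = exponent_mult q \<mu> P (c i)"
  shows "(\<exists>!QR. adapted_factorization q \<mu> p c m P QR) \<and>
    (\<forall>Q R. adapted_factorization q \<mu> p c m P (Q, R) \<longrightarrow>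
       newton_rank R = (\<lambda>\<nu>. if \<nu> = of_int \<mu> then \<Sum>i=1..p. m i else 0) \<and>
       laurent_eq (q_char_poly q \<mu> R)
         (\<Prod>i=1..p. (Poly_Mapping.single 1 1 - Poly_Mapping.single 0 (c i)) ^ m i))"
proof -
  have q0: "q \<noteq> 0" using q by auto
  define f where "f = laurent_to_poly (q_char_poly q \<mu> P)"
  define M where "M = Min (Poly_Mapping.keys (q_char_poly q \<mu> P))"
  define A where "A = c ` {1..p}"
  have A: "A = {d \<in> exponents q \<mu> P. cong_q q d a}" and inj: "inj_on c {1..p}"
    using c by (auto simp: bij_betw_def A_def)
  have c_exp: "c i \<noteq> 0" "cong_q q (c i) a" if "i \<in> {1..p}" for i
  proof -
    have "c i \<in> A" using that by (auto simp: A_def)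
    then show "c i \<noteq> 0" "cong_q q (c i) a" unfolding A by (auto simp: exponents_def)
  qed
  have chi_f: "q_char_poly q \<mu> P = laurent_of_poly f * Poly_Mapping.single M 1"
    unfolding f_def M_def by (rule laurent_to_poly_shift)
  have "f \<noteq> 0"
    using q_char_poly_nonzero[OF q0 P(2), of \<mu>] by (auto simp: chi_f laurent_of_poly_def)
  then obtain g0 where g0: "f = g0 * (\<Prod>d\<in>A. [:- d, 1:] ^ order d f)" "\<forall>d\<in>A. poly g0 d \<noteq> 0"
    using poly_order_decomp_finite[of A f] by (auto simp: A_def)
  \<comment> \<open>\<open>g\<close> is the characteristic polynomial of \<open>P\<close> without
    its zeros in the class of \<open>a\<close>; it will be that of \<open>Q\<close>.\<close>
  define g where "g = laurent_of_poly g0 * Poly_Mapping.single M 1"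
  have prod_A: "(\<Prod>d\<in>A. [:- d, 1:] ^ order d f) = (\<Prod>i\<in>{1..p}. [:- c i, 1:] ^ m i)"
    unfolding A_def prod.reindex[OF inj] by (intro prod.cong) (auto simp: m f_def exponent_mult_def)
  have chi: "q_char_poly q \<mu> P = g * (\<Prod>i=1..p. laurent_linear (c i) ^ m i)"
    unfolding chi_f g_def
    by (subst g0(1)) (simp only: prod_A laurent_of_poly_mult_prod[OF finite_atLeastAtMost] mult_ac)
  \<comment> \<open>A zero of \<open>g0\<close> in the class is a zero of \<open>f\<close>, hence
    lies in \<open>A\<close>, where \<open>g0\<close> does not vanish.\<close>
  have g_nonzero: "leval d g \<noteq> 0" if "d \<noteq> 0" "cong_q q d a" for d
  proof
    assume "leval d g = 0"
    then have 0: "poly g0 d = 0" using that by (simp add: g_def leval_mult leval_laurent_of_poly)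
    then have "poly f d = 0" by (subst g0(1)) simp
    then have "d \<in> A" unfolding A using that by (simp add: exponents_def f_def)
    then show False using g0(2) 0 by blast
  qed
  have cong_trans: "cong_q q d e" if "cong_q q d b" "cong_q q b e" for d b e
  proof -
    obtain k l where "d = q powi k * b" "b = q powi l * e" using \<open>cong_q q d b\<close> \<open>cong_q q b e\<close> by (auto simp: cong_q_def)
    then have "d = q powi (k + l) * e" using q0 by (simp add: power_int_add)
    then show ?thesis by (auto simp: cong_q_def)
  qed
  define xs where "xs = block_indices m p"
  define c' where "c' = (\<lambda>k :: nat \<times> nat. c (fst k))"
  have dist: "distinct xs" by (simp add: xs_def distinct_block_indices)
  have fst_xs: "fst k \<in> {1..p}" if "k \<in> set xs" for k
    using that by (auto simp: xs_def set_block_indices)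
  have chi': "q_char_poly q \<mu> P = g * (\<Prod>k\<in>set xs. laurent_linear (c' k))"
    unfolding chi xs_def c'_def prod_block_indices[of "\<lambda>i. laurent_linear (c i)"] ..
  have c'0: "c' k \<noteq> 0" if "k \<in> set xs" for k using c_exp(1)[OF fst_xs[OF that]] by (simp add: c'_def)
  have nonres: "leval (q ^ n * c' k) g \<noteq> 0 \<and> c' k \<noteq> q ^ n * c' k" if k: "k \<in> set xs" and n: "1 \<le> n" for k n
  proof
    have "cong_q q (q ^ n * c' k) (c' k)" unfolding cong_q_def by (intro exI[of _ "int n"]) simp
    then show "leval (q ^ n * c' k) g \<noteq> 0"
      using c_exp(2)[OF fst_xs[OF k]] c'0[OF k] q0
      by (intro g_nonzero) (auto simp: c'_def intro: cong_trans)
    show "c' k \<noteq> q ^ n * c' k" using q_epsilon_power_mult[OF q c'0[OF k], of n] n by auto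
  qed
  \<comment> \<open>An equality \<open>c' k = q ^ n * c' k'\<close> with n >= 1 would give
    \<open>k\<close> a strictly larger epsilon than \<open>k'\<close>, while epsilon never decreases
    along \<open>xs\<close>.\<close>
  have sorted: "sorted_wrt (\<lambda>k k'. \<forall>n\<ge>1. c' k \<noteq> q ^ n * c' k') xs"
  proof (rule sorted_wrt_mono_rel)
    show "sorted_wrt (\<lambda>k k'. fst k \<le> fst k') xs"
      unfolding xs_def block_indices_def by (intro sorted_wrt_concat_map_Pair) (rule sorted_wrt_upt)
    fix k k' assume k: "k \<in> set xs" "k' \<in> set xs" "fst k \<le> fst k'"
    then have "q_epsilon q (c' k) \<le> q_epsilon q (c' k')"
      using eps[of "fst k" "fst k'"] fst_xs[OF k(1)] fst_xs[OF k(2)]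
      by (cases "fst k = fst k'") (auto simp: c'_def)
    then show "\<forall>n\<ge>1. c' k \<noteq> q ^ n * c' k'"
      using q_epsilon_power_mult[OF q c'0[OF k(2)]] by auto
  qed
  note factor = right_elem_factors_exist_unique[OF q0 P(2) dist c'0 chi' nonres sorted]
  let ?w = "\<lambda>v. qprod_list q (map (\<lambda>k. elem_factor q \<mu> (c' k) (v k)) xs)"
  have block: "qprod_list q (map (\<lambda>i. block_factor q \<mu> (c i) (m i) (u i)) [1..<p + 1]) = ?w (case_prod u)" for u
    unfolding qprod_list_block_factors[OF q0] xs_def c'_def case_prod_beta ..
  have char_Q: "q_char_poly q \<mu> Q = g"
    if "P = qmult q Q (?w v)" "\<forall>k\<in>set xs. fps_nth (v k) 0 = 1" for Q v
  proof -
    have "Q \<noteq> 0" using that(1) P(2) by auto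
    then have "q_char_poly q \<mu> Q * (\<Prod>k\<in>set xs. laurent_linear (c' k)) =
        g * (\<Prod>k\<in>set xs. laurent_linear (c' k))"
      using qmult_elem_factors(2)[OF q0 _ dist, where Q = Q and u = v and c = c' and \<mu> = \<mu>] that chi' by simp
    then show ?thesis by simp
  qed
  have adapted_iff: "adapted_factorization q \<mu> p c m P (Q, R) \<longleftrightarrow>
      P = qmult q Q R \<and> (\<exists>v. (\<forall>k\<in>set xs. fps_nth (v k) 0 = 1) \<and> R = ?w v)" for Q R
  proof
    assume "adapted_factorization q \<mu> p c m P (Q, R)"
    then obtain u where u: "P = qmult q Q R" "\<forall>i\<in>{1..p}. \<forall>j\<in>{1..m i}. fps_nth (u i j) 0 = 1"
      "R = ?w (case_prod u)"
      unfolding adapted_factorization_def block by blast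
    moreover have "\<forall>k\<in>set xs. fps_nth (case_prod u k) 0 = 1"
      using u(2) by (auto simp: xs_def set_block_indices)
    ultimately show "P = qmult q Q R \<and> (\<exists>v. (\<forall>k\<in>set xs. fps_nth (v k) 0 = 1) \<and> R = ?w v)" by blast
  next
    assume "P = qmult q Q R \<and> (\<exists>v. (\<forall>k\<in>set xs. fps_nth (v k) 0 = 1) \<and> R = ?w v)"
    then obtain v where v: "P = qmult q Q R" "\<forall>k\<in>set xs. fps_nth (v k) 0 = 1" "R = ?w v" by blast
    \<comment> \<open>The exponents of \<open>Q\<close> are zeros of \<open>g\<close>, which has
      none in the class of \<open>a\<close>.\<close>
    have "\<not> cong_q q d (c i)" if d: "d \<in> exponents q \<mu> Q" and i: "i \<in> {1..p}" for d i
    proof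
      assume "cong_q q d (c i)"
      then have "cong_q q d a" using c_exp(2)[OF i] by (rule cong_trans)
      moreover have "d \<noteq> 0" "leval d g = 0"
        using d char_Q[of Q v] v by (auto simp: exponents_eq)
      ultimately show False using g_nonzero by blast
    qed
    moreover have "\<forall>i\<in>{1..p}. \<forall>j\<in>{1..m i}. fps_nth (curry v i j) 0 = 1"
      using v(2) by (auto simp: xs_def set_block_indices)
    ultimately show "adapted_factorization q \<mu> p c m P (Q, R)"
      unfolding adapted_factorization_def block using v(1,3)
      by (auto intro!: exI[of _ "curry v"])
  qed
  show ?thesis
  proof (intro conjI allI impI)
    obtain v Q where v: "\<forall>k\<in>set xs. fps_nth (v k) 0 = 1" "P = qmult q Q (?w v)"
      using factor(1) by blast
    show "\<exists>!QR. adapted_factorization q \<mu> p c m P QR"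
    proof (rule ex1I[of _ "(Q, ?w v)"])
      show "adapted_factorization q \<mu> p c m P (Q, ?w v)" unfolding adapted_iff using v by blast
      fix QR assume "adapted_factorization q \<mu> p c m P QR"
      then obtain Q' v' where v': "QR = (Q', ?w v')" "\<forall>k\<in>set xs. fps_nth (v' k) 0 = 1" "P = qmult q Q' (?w v')"
        by (cases QR) (auto simp: adapted_iff)
      have "Q' = Q \<and> (\<forall>k\<in>set xs. v' k = v k)"
        using factor(2)[OF _ _ _ v'(2) v(1) v'(3) v(2)] by blast
      \<comment> \<open>\<open>v'\<close> and \<open>v\<close> are known to agree only at the
        positions in \<open>xs\<close>, which suffices for the operators to coincide.\<close>
      moreover from this have "?w v' = ?w v"
        by (intro arg_cong[where f = "qprod_list q"] map_cong) auto
      ultimately show "QR = (Q, ?w v)" using v'(1) by simp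
    qed
  next
    fix Q R assume "adapted_factorization q \<mu> p c m P (Q, R)"
    then obtain v where v: "\<forall>k\<in>set xs. fps_nth (v k) 0 = 1" "R = ?w v"
      unfolding adapted_iff by blast
    have len: "length xs = (\<Sum>i=1..p. m i)" by (simp add: xs_def length_block_indices)
    show "newton_rank R = (\<lambda>\<nu>. if \<nu> = of_int \<mu> then \<Sum>i=1..p. m i else 0)"
      unfolding v(2) len[symmetric]
      by (rule newton_rank_qprod_list_elem_factors[OF q0]) (use v(1) c'0 in blast)
    \<comment> \<open>The product formula with left cofactor 1 then gives the characteristic
      polynomial of \<open>R\<close> exactly, so the unit in \<open>laurent_eq\<close> is 1.\<close>
    have one: "q_char_poly q \<mu> 1 = 1"
      by (simp add: q_char_poly_def twisted_coeff_def)
    have "q_char_poly q \<mu> R = (\<Prod>k\<in>set xs. laurent_linear (c' k))"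
      using qmult_elem_factors(2)[OF q0 _ dist, where Q = 1 and u = v and c = c' and \<mu> = \<mu>] v one by (simp add: qmult_1 q0)
    also have "\<dots> = (\<Prod>i=1..p. laurent_linear (c i) ^ m i)"
      unfolding xs_def c'_def by (rule prod_block_indices)
    finally show "laurent_eq (q_char_poly q \<mu> R) (\<Prod>i=1..p. laurent_linear (c i) ^ m i)"
      unfolding laurent_eq_def by (intro exI[of _ 1] exI[of _ 0]) simp
  qed
qed

end
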